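(* Let $\widetilde{\mathcal Q}$ be an extended quiver with even vertices $x_1,\ldots,x_n$ and odd vertices $\xi_1,\ldots,\xi_m$, and associate to it the differential 2-form $$\omega_{\widetilde{\mathcal Q}}=\sum_{x_i\to x_j}\frac{dx_i\wedge dx_j}{x_ix_j}+\sum_{\xi_i\to x_\ell\to\xi_j}\frac{d(\xi_i\xi_j)\wedge dx_\ell}{x_\ell},$$ where the first sum runs over the arrows of the underlying quiver and the second over the 2-paths of $\widetilde{\mathcal Q}$ (both with multiplicity). Then for every even vertex $x_k$, $\omega$ is invariant under the mutation $\widetilde\mu_k$ combined with the exchange relation: expressing $x_k$ in terms of $x_k'$ and the other variables via the exchange relation and substituting into $\omega_{\widetilde{\mathcal Q}}$, one obtains exactly the form $\omega_{\widetilde\mu_k(\widetilde{\mathcal Q})}$ written in the variables $x_1,\ldots,x_{k-1},x_k',x_{k+1},\ldots,x_n,\xi_1,\ldots,\xi_m$.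
   Context: Grassmann variables $\xi_1,\ldots,\xi_m$ are odd: they anticommute pairwise ($\xi_i\xi_j=-\xi_j\xi_i$, in particular $\xi_i^2=0$) and commute with the even variables $x_1,\ldots,x_n$; differential forms are taken in the corresponding supercommutative sense. Extended quiver: $\widetilde{\mathcal Q}$ consists of (A) an ordinary quiver $\mathcal Q$ (finite, no loops, no oriented 2-cycles, arrows counted with multiplicity) with vertices labeled by even variables $x_1,\ldots,x_n$; (B) $m$ additional odd vertices labeled $\xi_1,\ldots,\xi_m$; (C) a finite multiset of oriented 2-paths $(\xi_i\to x_k\to\xi_j)$, $i\ne j$, through even vertices, with no even vertex carrying both a 2-path $\xi_i\to x_k\to\xi_j$ and the opposite one $\xi_j\to x_k\to\xi_i$. Mutation $\widetilde\mu_k$ at an even vertex $x_k$: (0) the underlying quiver $\mathcal Q$ undergoes the usual Fomin–Zelevinsky quiver mutation at $x_k$; (1* ) for every 2-path $(\xi_i\to x_k\to\xi_j)$ and every arrow $x_k\to x_\ell$ (with multiplicity), add a 2-path $(\xi_i\to x_\ell\to\xi_j)$; (2* ) reverse every 2-path through $x_k$, $(\xi_i\to x_k\to\xi_j)$ becoming $(\xi_j\to x_k\to\xi_i)$; (3* ) cancel two by two pairs of opposite 2-paths $(\xi_i\to x_\ell\to\xi_j)$, $(\xi_j\to x_\ell\to\xi_i)$ through the same even vertex. Exchange relation: $\widetilde\mu_k$ replaces $x_k$ by $x_k'$ (other variables unchanged) with $$x_kx_k'=\prod_{x_k\to x_\ell}x_\ell+\prod_{\xi_i\to x_k\to\xi_j}(1+\xi_i\xi_j)\prod_{x_\ell\to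 x_k}x_\ell,$$ products over arrows and 2-paths of $\widetilde{\mathcal Q}$ with multiplicity. *)

theory Defs
  imports Main "HOL-Library.Poly_Mapping" "HOL-Computational_Algebra.Fraction_Field"
begin

section \<open>Exterior algebra on a linearly ordered set of odd generators\<close>

text \<open>
  An element is a finite linear combination of the monomials e(S), where S is a finite set of
  generators and e(S) is the product of its elements in increasing order.  The order on the
  generators only selects this basis.
\<close>

definition shuffle_sign :: "'g::linorder set \<Rightarrow> 'g set \<Rightarrow> 'r::comm_ring_1" where
  "shuffle_sign S T = (-1) ^ card {(s, t). s \<in> S \<and> t \<in> T \<and> t < s}"

typedef (overloaded) ('g, 'r) grassmann =
  "{f :: 'g set \<Rightarrow> 'r::zero. finite {S. f S \<noteq> 0} \<and> (\<forall>S. f S \<noteq> 0 \<longrightarrow> finite S)}"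
  morphisms gr_coeff Abs_grassmann
  by (rule exI[of _ "\<lambda>_. 0"]) simp

setup_lifting type_definition_grassmann

lemma gr_eqI: "(\<And>S. gr_coeff a S = gr_coeff b S) \<Longrightarrow> a = b"
  by transfer auto

lemma gr_coeff_infinite: "infinite S \<Longrightarrow> gr_coeff a S = 0"
  by transfer auto

lemma shuffle_sign_union_left:
  assumes "finite S" "finite T" "finite U" "S \<inter> T = {}"
  shows "shuffle_sign (S \<union> T) U = shuffle_sign S U * shuffle_sign T U"
proof -
  have eq: "{(s, t). s \<in> S \<union> T \<and> t \<in> U \<and> t < s} =
      {(s, t). s \<in> S \<and> t \<in> U \<and> t < s} \<union> {(s, t). s \<in> T \<and> t \<in> U \<and> t < s}"
    by auto
  have fin: "finite {(s, t). s \<in> S \<and> t \<in> U \<and> t < s}" "finite {(s, t). s \<in> T \<and> t \<in> U \<and> t < s}"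
    using assms by (auto intro: finite_subset[of _ "S \<times> U"] finite_subset[of _ "T \<times> U"])
  have "card {(s, t). s \<in> S \<union> T \<and> t \<in> U \<and> t < s} =
      card {(s, t). s \<in> S \<and> t \<in> U \<and> t < s} + card {(s, t). s \<in> T \<and> t \<in> U \<and> t < s}"
    unfolding eq by (rule card_Un_disjoint) (use fin assms(4) in auto)
  then show ?thesis by (simp add: shuffle_sign_def power_add)
qed

lemma shuffle_sign_union_right:
  assumes "finite S" "finite T" "finite U" "T \<inter> U = {}"
  shows "shuffle_sign S (T \<union> U) = shuffle_sign S T * shuffle_sign S U"
proof -
  have eq: "{(s, t). s \<in> S \<and> t \<in> T \<union> U \<and> t < s} =
      {(s, t). s \<in> S \<and> t \<in> T \<and> t < s} \<union> {(s, t). s \<in> S \<and> t \<in> U \<and> t < s}"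
    by auto
  have fin: "finite {(s, t). s \<in> S \<and> t \<in> T \<and> t < s}" "finite {(s, t). s \<in> S \<and> t \<in> U \<and> t < s}"
    using assms by (auto intro: finite_subset[of _ "S \<times> T"] finite_subset[of _ "S \<times> U"])
  have "card {(s, t). s \<in> S \<and> t \<in> T \<union> U \<and> t < s} =
      card {(s, t). s \<in> S \<and> t \<in> T \<and> t < s} + card {(s, t). s \<in> S \<and> t \<in> U \<and> t < s}"
    unfolding eq by (rule card_Un_disjoint) (use fin assms(4) in auto)
  then show ?thesis by (simp add: shuffle_sign_def power_add)
qed

lemma shuffle_sign_empty [simp]: "shuffle_sign {} T = 1" "shuffle_sign S {} = 1"
  by (simp_all add: shuffle_sign_def)

instantiation grassmann :: (linorder, comm_ring_1) ring_1
begin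

lift_definition zero_grassmann :: "('a, 'b) grassmann" is "\<lambda>_. 0"
  by simp

lift_definition one_grassmann :: "('a, 'b) grassmann" is "\<lambda>S. if S = {} then 1 else 0"
  by simp

lift_definition plus_grassmann ::
  "('a, 'b) grassmann \<Rightarrow> ('a, 'b) grassmann \<Rightarrow> ('a, 'b) grassmann" is "\<lambda>f g S. f S + g S"
proof (intro conjI)
  fix f g :: "'a set \<Rightarrow> 'b"
  assume f: "finite {S. f S \<noteq> 0} \<and> (\<forall>S. f S \<noteq> 0 \<longrightarrow> finite S)"
    and g: "finite {S. g S \<noteq> 0} \<and> (\<forall>S. g S \<noteq> 0 \<longrightarrow> finite S)"
  show "finite {S. f S + g S \<noteq> 0}"
    by (rule finite_subset[of _ "{S. f S \<noteq> 0} \<union> {S. g S \<noteq> 0}"]) (use f g in auto)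
  show "\<forall>S. f S + g S \<noteq> 0 \<longrightarrow> finite S"
    using f g by (metis add_0)
qed

lift_definition uminus_grassmann :: "('a, 'b) grassmann \<Rightarrow> ('a, 'b) grassmann"
  is "\<lambda>f S. - f S"
  by simp

definition minus_grassmann ::
  "('a, 'b) grassmann \<Rightarrow> ('a, 'b) grassmann \<Rightarrow> ('a, 'b) grassmann" where
  "minus_grassmann a b = a + - b"

lift_definition times_grassmann ::
  "('a, 'b) grassmann \<Rightarrow> ('a, 'b) grassmann \<Rightarrow> ('a, 'b) grassmann"
  is "\<lambda>f g U. \<Sum>S\<in>Pow U. shuffle_sign S (U - S) * f S * g (U - S)"
proof (intro conjI)
  fix f g :: "'a set \<Rightarrow> 'b"
  assume f: "finite {S. f S \<noteq> 0} \<and> (\<forall>S. f S \<noteq> 0 \<longrightarrow> finite S)"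
    and g: "finite {S. g S \<noteq> 0} \<and> (\<forall>S. g S \<noteq> 0 \<longrightarrow> finite S)"
  let ?h = "\<lambda>U. \<Sum>S\<in>Pow U. shuffle_sign S (U - S) * f S * g (U - S)"
  have *: "\<exists>S\<subseteq>U. f S \<noteq> 0 \<and> g (U - S) \<noteq> 0" if "?h U \<noteq> 0" for U
  proof (rule ccontr)
    assume "\<not> ?thesis"
    then have "?h U = 0" by (intro sum.neutral) auto
    with that show False by simp
  qed
  have "{U. ?h U \<noteq> 0} \<subseteq> (\<lambda>(S, T). S \<union> T) ` ({S. f S \<noteq> 0} \<times> {S. g S \<noteq> 0})"
  proof
    fix U assume "U \<in> {U. ?h U \<noteq> 0}"
    then obtain S where "S \<subseteq> U" "f S \<noteq> 0" "g (U - S) \<noteq> 0" using * by blast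
    then show "U \<in> (\<lambda>(S, T). S \<union> T) ` ({S. f S \<noteq> 0} \<times> {S. g S \<noteq> 0})"
      by (intro image_eqI[of _ _ "(S, U - S)"]) auto
  qed
  then show "finite {U. ?h U \<noteq> 0}"
    by (rule finite_subset) (use f g in simp)
  show "\<forall>U. ?h U \<noteq> 0 \<longrightarrow> finite U"
    by (meson finite_Pow_iff sum.infinite)
qed

instance
proof
  fix a b c :: "('a, 'b) grassmann"
  show "a + b + c = a + (b + c)" by transfer (simp add: add.assoc)
  show "a + b = b + a" by transfer (simp add: add.commute)
  show "0 + a = a" by transfer simp
  show "- a + a = 0" by transfer simp
  show "a - b = a + - b" by (rule minus_grassmann_def)
  show "(0::('a, 'b) grassmann) \<noteq> 1"
    by transfer (auto dest: fun_cong[of _ _ "{}"])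
  show "(a + b) * c = a * c + b * c"
    by transfer (simp add: algebra_simps sum.distrib)
  show "a * (b + c) = a * b + a * c"
    by transfer (simp add: algebra_simps sum.distrib)
  show "1 * a = a"
  proof (rule gr_eqI)
    fix U
    show "gr_coeff (1 * a) U = gr_coeff a U"
    proof (cases "finite U")
      case True
      have "gr_coeff (1 * a) U =
          (\<Sum>S\<in>Pow U. if {} = S then gr_coeff a U else 0)"
        unfolding times_grassmann.rep_eq one_grassmann.rep_eq by (rule sum.cong) auto
      then show ?thesis using True by (subst (asm) sum.delta') auto
    qed (simp add: gr_coeff_infinite)
  qed
  show "a * 1 = a"
  proof (rule gr_eqI)
    fix U
    show "gr_coeff (a * 1) U = gr_coeff a U"
    proof (cases "finite U")
      case True
      have "gr_coeff (a * 1) U =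
          (\<Sum>S\<in>Pow U. if U = S then gr_coeff a U else 0)"
        unfolding times_grassmann.rep_eq one_grassmann.rep_eq by (rule sum.cong) auto
      then show ?thesis using True by (subst (asm) sum.delta') auto
    qed (simp add: gr_coeff_infinite)
  qed
  show "a * b * c = a * (b * c)"
  proof (rule gr_eqI)
    fix U
    show "gr_coeff (a * b * c) U = gr_coeff (a * (b * c)) U"
    proof (cases "finite U")
      case True
      let ?a = "gr_coeff a" and ?b = "gr_coeff b" and ?c = "gr_coeff c"
      have "gr_coeff (a * b * c) U = (\<Sum>S\<in>Pow U. \<Sum>T\<in>Pow S.
          shuffle_sign S (U - S) * (shuffle_sign T (S - T) * ?a T * ?b (S - T)) * ?c (U - S))"
        by (simp add: times_grassmann.rep_eq sum_distrib_left sum_distrib_right)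
      also have "\<dots> = (\<Sum>(S, T)\<in>Sigma (Pow U) Pow.
          shuffle_sign S (U - S) * (shuffle_sign T (S - T) * ?a T * ?b (S - T)) * ?c (U - S))"
        using True by (subst sum.Sigma) (auto dest: finite_subset)
      also have "\<dots> = (\<Sum>(T, V)\<in>Sigma (Pow U) (\<lambda>T. Pow (U - T)).
          shuffle_sign T (U - T) * ?a T * (shuffle_sign V (U - T - V) * ?b V * ?c (U - T - V)))"
      proof (rule sum.reindex_bij_witness[where j = "\<lambda>(S, T). (T, S - T)" and i = "\<lambda>(T, V). (T \<union> V, T)"])
        fix p assume "p \<in> Sigma (Pow U) Pow"
        then obtain S T where p: "p = (S, T)" "S \<subseteq> U" "T \<subseteq> S" by auto
        have fin: "finite S" "finite T" "finite (U - S)" "finite (S - T)"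
          using True p by (auto dest: finite_subset)
        have e1: "(shuffle_sign S (U - S) :: 'b) =
            shuffle_sign T (U - S) * shuffle_sign (S - T) (U - S)"
        proof -
          have "S = T \<union> (S - T)" using p by auto
          then show ?thesis using shuffle_sign_union_left[of T "S - T" "U - S"] fin
            by (metis Diff_disjoint)
        qed
        have e2: "(shuffle_sign T (U - T) :: 'b) = shuffle_sign T (S - T) * shuffle_sign T (U - S)"
        proof -
          have "U - T = (S - T) \<union> (U - S)" "(S - T) \<inter> (U - S) = {}" using p by auto
          then show ?thesis using shuffle_sign_union_right[of T "S - T" "U - S"] fin by simp
        qed
        have e3: "U - T - (S - T) = U - S" using p by auto
        show "(case (case p of (S, T) \<Rightarrow> (T, S - T)) of (T, V) \<Rightarrow>
            shuffle_sign T (U - T) * ?a T * (shuffle_sign V (U - T - V) * ?b V * ?c (U - T - V))) =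
          (case p of (S, T) \<Rightarrow>
            shuffle_sign S (U - S) * (shuffle_sign T (S - T) * ?a T * ?b (S - T)) * ?c (U - S))"
          by (simp add: p(1) e1 e2 e3 mult_ac)
      qed auto
      also have "\<dots> = (\<Sum>T\<in>Pow U. \<Sum>V\<in>Pow (U - T).
          shuffle_sign T (U - T) * ?a T * (shuffle_sign V (U - T - V) * ?b V * ?c (U - T - V)))"
        using True by (subst sum.Sigma) auto
      also have "\<dots> = gr_coeff (a * (b * c)) U"
        by (simp add: times_grassmann.rep_eq sum_distrib_left)
      finally show ?thesis .
    qed (simp add: gr_coeff_infinite)
  qed
qed

end

text \<open>The two-sided inverse of a unit; as usual in HOL, 0 for an element that is not a unit.\<close>

instantiation grassmann :: (linorder, comm_ring_1) inverse
begin

definition inverse_grassmann :: "('a, 'b) grassmann \<Rightarrow> ('a, 'b) grassmann" where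
  "inverse_grassmann a =
     (if \<exists>b. a * b = 1 \<and> b * a = 1 then (THE b. a * b = 1 \<and> b * a = 1) else 0)"

definition divide_grassmann ::
  "('a, 'b) grassmann \<Rightarrow> ('a, 'b) grassmann \<Rightarrow> ('a, 'b) grassmann" where
  "divide_grassmann a b = a * inverse b"

instance ..

end

lift_definition gr_const :: "'r \<Rightarrow> ('g::linorder, 'r::comm_ring_1) grassmann"
  is "\<lambda>c S. if S = {} then c else 0"
  by simp

lemma gr_const_0 [simp]: "gr_const 0 = 0" and gr_const_1 [simp]: "gr_const 1 = 1"
  by (rule gr_eqI; simp add: gr_const.rep_eq zero_grassmann.rep_eq one_grassmann.rep_eq)+

lift_definition gr_gen :: "'g \<Rightarrow> ('g::linorder, 'r::comm_ring_1) grassmann"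
  is "\<lambda>g S. if S = {g} then 1 else 0"
  by simp

lift_definition gr_map ::
  "('r \<Rightarrow> 's) \<Rightarrow> ('g::linorder, 'r::comm_ring_1) grassmann \<Rightarrow> ('g, 's::comm_ring_1) grassmann"
  is "\<lambda>h f S. if f S = 0 then 0 else h (f S)"
  by (auto elim!: rev_finite_subset split: if_splits)

text \<open>The left derivative with respect to the odd generator g.\<close>

lift_definition gr_contract ::
  "'g \<Rightarrow> ('g::linorder, 'r::comm_ring_1) grassmann \<Rightarrow> ('g, 'r) grassmann"
  is "\<lambda>g f S. if g \<in> S then 0 else shuffle_sign {g} S * f (insert g S)"
proof (intro conjI)
  fix g :: 'g and f :: "'g set \<Rightarrow> 'r"
  assume f: "finite {S. f S \<noteq> 0} \<and> (\<forall>S. f S \<noteq> 0 \<longrightarrow> finite S)"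
  let ?h = "\<lambda>S. if g \<in> S then 0 else shuffle_sign {g} S * f (insert g S)"
  have *: "g \<notin> S \<and> f (insert g S) \<noteq> 0" if "?h S \<noteq> 0" for S
    using that by (auto split: if_splits)
  have "{S. ?h S \<noteq> 0} \<subseteq> (\<lambda>S. S - {g}) ` {S. f S \<noteq> 0}"
  proof
    fix S assume "S \<in> {S. ?h S \<noteq> 0}"
    then have "g \<notin> S" "f (insert g S) \<noteq> 0" using * by blast+
    then show "S \<in> (\<lambda>S. S - {g}) ` {S. f S \<noteq> 0}"
      by (intro image_eqI[of _ _ "insert g S"]) auto
  qed
  then show "finite {S. ?h S \<noteq> 0}"
    by (rule finite_subset) (use f in simp)
  show "\<forall>S. ?h S \<noteq> 0 \<longrightarrow> finite S"
    using * f by (metis finite_insert)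
qed

lemma gr_gen_sq: "gr_gen g * gr_gen g = (0 :: ('g::linorder, 'r::comm_ring_1) grassmann)"
proof (rule gr_eqI)
  fix U
  show "gr_coeff (gr_gen g * gr_gen g) U = gr_coeff (0 :: ('g, 'r) grassmann) U"
    unfolding times_grassmann.rep_eq gr_gen.rep_eq zero_grassmann.rep_eq
    by (rule sum.neutral) auto
qed

lemma gr_gen_mult:
  assumes "g \<noteq> h"
  shows "gr_coeff (gr_gen g * gr_gen h :: ('g::linorder, 'r::comm_ring_1) grassmann) U =
    (if U = {g, h} then shuffle_sign {g} {h} else 0)"
proof (cases "U = {g, h}")
  case True
  have "gr_coeff (gr_gen g * gr_gen h :: ('g, 'r) grassmann) U =
     (\<Sum>S\<in>Pow U. if S = {g} then shuffle_sign {g} {h} else 0)"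
    unfolding times_grassmann.rep_eq gr_gen.rep_eq
    by (rule sum.cong) (use True assms in \<open>auto simp: insert_Diff_if\<close>)
  also have "\<dots> = shuffle_sign {g} {h}"
    using True by (subst sum.delta) auto
  finally show ?thesis using True by simp
next
  case False
  then show ?thesis
    unfolding times_grassmann.rep_eq gr_gen.rep_eq
    by (auto intro!: sum.neutral split: if_splits)
qed

lemma gr_gen_anticommute:
  "gr_gen g * gr_gen h = - (gr_gen h * gr_gen g :: ('g::linorder, 'r::comm_ring_1) grassmann)"
proof (cases "g = h")
  case False
  have set1: "{(s, t). s = g \<and> t = h \<and> t < s} = (if h < g then {(g, h)} else {})"
    and set2: "{(s, t). s = h \<and> t = g \<and> t < s} = (if g < h then {(h, g)} else {})" by auto
  have "(shuffle_sign {g} {h} :: 'r) = - shuffle_sign {h} {g}"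
    using False by (auto simp: shuffle_sign_def set1 set2)
  then show ?thesis
    using False by (intro gr_eqI) (auto simp: gr_gen_mult uminus_grassmann.rep_eq insert_commute)
qed (simp add: gr_gen_sq)


section \<open>Rational functions and their partial derivatives\<close>

text \<open>Polynomials, and rational functions, over 'k in countably many variables indexed by nat.\<close>

type_synonym 'k mpoly = "(nat \<Rightarrow>\<^sub>0 nat) \<Rightarrow>\<^sub>0 'k"

type_synonym 'k ratfun = "'k mpoly fract"

definition mvar :: "nat \<Rightarrow> 'k::comm_ring_1 mpoly" where
  "mvar i = Poly_Mapping.single (Poly_Mapping.single i 1) 1"

definition mpoly_deriv :: "nat \<Rightarrow> 'k::comm_ring_1 mpoly \<Rightarrow> 'k mpoly" where
  "mpoly_deriv i p = (\<Sum>\<alpha>\<in>Poly_Mapping.keys p.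
     Poly_Mapping.single (\<alpha> - Poly_Mapping.single i 1)
       (of_nat (Poly_Mapping.lookup \<alpha> i) * Poly_Mapping.lookup p \<alpha>))"

lemma mpoly_deriv_superset:
  assumes "finite A" "Poly_Mapping.keys p \<subseteq> A"
  shows "mpoly_deriv i p = (\<Sum>\<alpha>\<in>A.
     Poly_Mapping.single (\<alpha> - Poly_Mapping.single i 1)
       (of_nat (Poly_Mapping.lookup \<alpha> i) * Poly_Mapping.lookup p \<alpha>))"
  unfolding mpoly_deriv_def
  by (rule sum.mono_neutral_left) (use assms in \<open>auto simp: in_keys_iff\<close>)

lemma mpoly_deriv_zero [simp]: "mpoly_deriv i 0 = 0"
  by (simp add: mpoly_deriv_def)

lemma mpoly_deriv_add: "mpoly_deriv i (p + q) = mpoly_deriv i p + mpoly_deriv i q"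
proof -
  let ?A = "Poly_Mapping.keys p \<union> Poly_Mapping.keys q"
  have "finite ?A" "Poly_Mapping.keys (p + q) \<subseteq> ?A" by (auto simp: keys_add)
  then show ?thesis
    by (simp add: mpoly_deriv_superset[of ?A] lookup_add distrib_left single_add sum.distrib)
qed

lemma mpoly_deriv_sum: "mpoly_deriv i (sum f A) = (\<Sum>a\<in>A. mpoly_deriv i (f a))"
  by (induction A rule: infinite_finite_induct) (simp_all add: mpoly_deriv_add)

lemma mpoly_deriv_single: "mpoly_deriv i (Poly_Mapping.single \<alpha> c) =
    Poly_Mapping.single (\<alpha> - Poly_Mapping.single i 1) (of_nat (Poly_Mapping.lookup \<alpha> i) * c)"
  by (subst mpoly_deriv_superset[of "{\<alpha>}"]) auto

lemma mpoly_eq_sum_single: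
  fixes p :: "'a \<Rightarrow>\<^sub>0 'b::comm_monoid_add"
  shows "p = (\<Sum>\<alpha>\<in>Poly_Mapping.keys p. Poly_Mapping.single \<alpha> (Poly_Mapping.lookup p \<alpha>))"
proof (rule poly_mapping_eqI)
  fix \<beta>
  show "Poly_Mapping.lookup p \<beta> =
    Poly_Mapping.lookup (\<Sum>\<alpha>\<in>Poly_Mapping.keys p. Poly_Mapping.single \<alpha> (Poly_Mapping.lookup p \<alpha>)) \<beta>"
    by (auto simp: lookup_sum lookup_single when_def in_keys_iff)
qed

lemma mpoly_deriv_mult_single:
  "mpoly_deriv i (Poly_Mapping.single \<alpha> a * Poly_Mapping.single \<beta> b) =
     mpoly_deriv i (Poly_Mapping.single \<alpha> a) * Poly_Mapping.single \<beta> b +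
     Poly_Mapping.single \<alpha> a * mpoly_deriv i (Poly_Mapping.single \<beta> (b::'k::comm_ring_1))"
proof -
  have shift: "\<alpha> - Poly_Mapping.single i 1 + \<beta> = \<alpha> + \<beta> - Poly_Mapping.single i 1"
    if "Poly_Mapping.lookup \<alpha> i \<noteq> 0" for \<alpha> \<beta> :: "nat \<Rightarrow>\<^sub>0 nat"
    using that by (intro poly_mapping_eqI) (auto simp: lookup_add lookup_minus lookup_single when_def)
  have A: "Poly_Mapping.single (\<alpha> - Poly_Mapping.single i 1 + \<beta>)
        (of_nat (Poly_Mapping.lookup \<alpha> i) * (a * b)) =
      Poly_Mapping.single (\<alpha> + \<beta> - Poly_Mapping.single i 1)
        (of_nat (Poly_Mapping.lookup \<alpha> i) * (a * b))"
    using shift[of \<alpha> \<beta>] by (cases "Poly_Mapping.lookup \<alpha> i = 0") auto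
  have B: "Poly_Mapping.single (\<alpha> + (\<beta> - Poly_Mapping.single i 1))
        (of_nat (Poly_Mapping.lookup \<beta> i) * (a * b)) =
      Poly_Mapping.single (\<alpha> + \<beta> - Poly_Mapping.single i 1)
        (of_nat (Poly_Mapping.lookup \<beta> i) * (a * b))"
    using shift[of \<beta> \<alpha>] by (cases "Poly_Mapping.lookup \<beta> i = 0") (auto simp: add.commute)
  show ?thesis
    using A B
    by (simp add: mult_single mpoly_deriv_single lookup_add single_add algebra_simps)
qed

lemma mpoly_deriv_mult:
  "mpoly_deriv i (p * q) = mpoly_deriv i p * q + p * mpoly_deriv i (q::'k::comm_ring_1 mpoly)"
proof -
  let ?P = "\<lambda>\<alpha>. Poly_Mapping.single \<alpha> (Poly_Mapping.lookup p \<alpha>)"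
  let ?Q = "\<lambda>\<alpha>. Poly_Mapping.single \<alpha> (Poly_Mapping.lookup q \<alpha>)"
  let ?K = "Poly_Mapping.keys p" and ?L = "Poly_Mapping.keys q"
  have p: "p = sum ?P ?K" and q: "q = sum ?Q ?L" by (rule mpoly_eq_sum_single)+
  have "mpoly_deriv i (sum ?P ?K * sum ?Q ?L) =
      mpoly_deriv i (sum ?P ?K) * sum ?Q ?L + sum ?P ?K * mpoly_deriv i (sum ?Q ?L)"
    by (simp add: sum_product mpoly_deriv_sum mpoly_deriv_mult_single sum.distrib)
  then show ?thesis using p q by simp
qed

lift_definition rat_deriv :: "nat \<Rightarrow> 'k::idom ratfun \<Rightarrow> 'k ratfun"
  is "\<lambda>i (p, q). (mpoly_deriv i p * q - p * mpoly_deriv i q, q * q)"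
proof (clarsimp)
  fix i :: nat and p q r s :: "'k mpoly"
  assume nz: "q \<noteq> 0" "s \<noteq> 0" and eq: "p * s = r * q"
  have D: "mpoly_deriv i p * s + p * mpoly_deriv i s = mpoly_deriv i r * q + r * mpoly_deriv i q"
    using arg_cong[OF eq, of "mpoly_deriv i"] by (simp add: mpoly_deriv_mult)
  show "(mpoly_deriv i p * q - p * mpoly_deriv i q) * (s * s) =
      (mpoly_deriv i r * s - r * mpoly_deriv i s) * (q * q)"
    using D eq by algebra
qed

lemma rat_deriv_Fract:
  "q \<noteq> 0 \<Longrightarrow> rat_deriv i (Fract p q) = Fract (mpoly_deriv i p * q - p * mpoly_deriv i q) (q * q)"
  unfolding Fract_def by (simp add: rat_deriv.abs_eq)

lemma mpoly_deriv_one: "mpoly_deriv i 1 = 0"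
  using mpoly_deriv_single[of i 0 1] by simp

lemma rat_deriv_one [simp]: "rat_deriv i 1 = 0"
  using rat_deriv_Fract[of 1 i 1] by (simp add: mpoly_deriv_one fract_collapse)

lemma rat_deriv_zero [simp]: "rat_deriv i 0 = 0"
  using rat_deriv_Fract[of 1 i 0] by (simp add: fract_collapse)

lemma rat_deriv_mvar: "rat_deriv i (Fract (mvar j) 1) = (if i = j then 1 else 0)"
proof -
  have "mpoly_deriv i (mvar j :: 'a mpoly) = (if i = j then 1 else 0)"
    by (simp add: mvar_def mpoly_deriv_single lookup_single)
  then show ?thesis
    by (simp add: rat_deriv_Fract mpoly_deriv_one fract_collapse)
qed


section \<open>Differential forms in even and odd variables\<close>

text \<open>
  Superforms in even variables x(i) and odd variables xi(j) form the free supercommutative algebra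
  over the rational functions in the x(i) with odd generators xi(j), dx(i) and even (hence
  commuting) generators dxi(j); multiplication is the wedge product.  The exterior differential is
  an odd derivation, that is, parity is total parity: Grassmann parity plus form degree.
  Variables are indexed from 0.
\<close>

datatype odd_gen = Xi nat | Dx nat

instantiation odd_gen :: linorder
begin

fun rank_odd_gen :: "odd_gen \<Rightarrow> int" where
  "rank_odd_gen (Xi j) = - int j - 1"
| "rank_odd_gen (Dx i) = int i"

definition less_eq_odd_gen :: "odd_gen \<Rightarrow> odd_gen \<Rightarrow> bool" where
  "g \<le> h \<longleftrightarrow> rank_odd_gen g \<le> rank_odd_gen h"

definition less_odd_gen :: "odd_gen \<Rightarrow> odd_gen \<Rightarrow> bool" where
  "g < h \<longleftrightarrow> rank_odd_gen g < rank_odd_gen h"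

instance
proof
  fix g h :: odd_gen
  show "g \<le> h \<Longrightarrow> h \<le> g \<Longrightarrow> g = h"
    by (cases g; cases h) (auto simp: less_eq_odd_gen_def)
qed (auto simp: less_eq_odd_gen_def less_odd_gen_def)

end

text \<open>The coefficient ring is the ring of polynomials in the dxi(j) over the rational functions.\<close>

type_synonym 'k superform = "(odd_gen, 'k ratfun mpoly) grassmann"

definition X :: "nat \<Rightarrow> 'k::field_char_0 superform" where
  "X i = gr_const (Poly_Mapping.single 0 (Fract (mvar i) 1))"

definition \<Xi> :: "nat \<Rightarrow> 'k::field_char_0 superform" where
  "\<Xi> j = gr_gen (Xi j)"

definition dX :: "nat \<Rightarrow> 'k::field_char_0 superform" where
  "dX i = gr_gen (Dx i)"

definition d\<Xi> :: "nat \<Rightarrow> 'k::field_char_0 superform" where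
  "d\<Xi> j = gr_const (mvar j)"

definition partial_even :: "nat \<Rightarrow> 'k::field_char_0 superform \<Rightarrow> 'k superform" where
  "partial_even i = gr_map (Poly_Mapping.map (rat_deriv i))"

definition partial_odd :: "nat \<Rightarrow> 'k::field_char_0 superform \<Rightarrow> 'k superform" where
  "partial_odd j = gr_contract (Xi j)"

definition ext_d :: "nat \<Rightarrow> nat \<Rightarrow> 'k::field_char_0 superform \<Rightarrow> 'k superform" where
  "ext_d n m \<omega> = (\<Sum>i<n. dX i * partial_even i \<omega>) + (\<Sum>j<m. d\<Xi> j * partial_odd j \<omega>)"

lemma partial_even_X: "partial_even i (X j) = (if i = j then 1 else 0)"
proof -
  have h: "gr_map h (gr_const c) = gr_const (if c = 0 then 0 else h c)"
    for h :: "'a ratfun mpoly \<Rightarrow> 'a ratfun mpoly" and c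
    by (rule gr_eqI) (simp add: gr_const.rep_eq gr_map.rep_eq)
  have nz: "mvar j \<noteq> (0 :: 'a mpoly)"
    by (metis mvar_def lookup_single_eq lookup_zero zero_neq_one)
  then have "Fract (mvar j :: 'a mpoly) 1 \<noteq> 0" 
    by (simp add: Zero_fract_def eq_fract)
  then have "Poly_Mapping.single 0 (Fract (mvar j :: 'a mpoly) 1) \<noteq> (0 :: 'a ratfun mpoly)"
    by (metis lookup_single_eq lookup_zero)
  then show ?thesis
    by (simp add: partial_even_def X_def h rat_deriv_mvar)
qed

lemma partial_even_\<Xi>: "partial_even i (\<Xi> j) = 0"
proof -
  have "Poly_Mapping.map (rat_deriv i) (1 :: 'a ratfun mpoly) = 0"
    using map_single[of "1 :: 'a ratfun" "rat_deriv i" 0] by simp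
  then show ?thesis
    unfolding partial_even_def \<Xi>_def
    by (intro gr_eqI) (simp add: gr_map.rep_eq gr_gen.rep_eq zero_grassmann.rep_eq)
qed

lemma partial_odd_X: "partial_odd j (X i) = 0"
  unfolding partial_odd_def X_def
  by (rule gr_eqI) (simp add: gr_contract.rep_eq gr_const.rep_eq zero_grassmann.rep_eq)

lemma partial_odd_\<Xi>: "partial_odd i (\<Xi> j) = (if i = j then 1 else 0)"
  unfolding partial_odd_def \<Xi>_def
  by (rule gr_eqI)
    (auto simp: gr_contract.rep_eq gr_gen.rep_eq zero_grassmann.rep_eq one_grassmann.rep_eq)

lemma ext_d_X: "i < n \<Longrightarrow> ext_d n m (X i) = dX i"
  by (simp add: ext_d_def partial_even_X partial_odd_X if_distrib[of "\<lambda>a. _ * a"] cong: if_cong)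

lemma ext_d_\<Xi>: "j < m \<Longrightarrow> ext_d n m (\<Xi> j) = d\<Xi> j"
  by (simp add: ext_d_def partial_even_\<Xi> partial_odd_\<Xi> if_distrib[of "\<lambda>a. _ * a"] cong: if_cong)


section \<open>Extended quivers\<close>

text \<open>
  \<open>arr Q i j\<close> is the number of arrows from x(i) to x(j), and \<open>tp Q i l j\<close> is the number of 2-paths
  from xi(i) through x(l) to xi(j).
\<close>

record ext_quiver =
  arr :: "nat \<Rightarrow> nat \<Rightarrow> nat"
  tp :: "nat \<Rightarrow> nat \<Rightarrow> nat \<Rightarrow> nat"

definition extended_quiver :: "nat \<Rightarrow> nat \<Rightarrow> ext_quiver \<Rightarrow> bool" where
  "extended_quiver n m Q \<longleftrightarrow>
     (\<forall>i j. arr Q i j \<noteq> 0 \<longrightarrow> i < n \<and> j < n) \<and>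
     (\<forall>i. arr Q i i = 0) \<and>
     (\<forall>i j. arr Q i j = 0 \<or> arr Q j i = 0) \<and>
     (\<forall>i l j. tp Q i l j \<noteq> 0 \<longrightarrow> i < m \<and> l < n \<and> j < m) \<and>
     (\<forall>i l. tp Q i l i = 0) \<and>
     (\<forall>i l j. tp Q i l j = 0 \<or> tp Q j l i = 0)"

definition quiver_mutate :: "nat \<Rightarrow> (nat \<Rightarrow> nat \<Rightarrow> nat) \<Rightarrow> nat \<Rightarrow> nat \<Rightarrow> nat" where
  "quiver_mutate k a =
     (let added = (\<lambda>i j. a i j + a i k * a k j);
          reversed = (\<lambda>i j. if i = k \<or> j = k then added j i else added i j)
      in (\<lambda>i j. reversed i j - reversed j i))"

text \<open>In both mutations truncated subtraction cancels all pairs of opposite arrows or 2-paths.\<close>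

definition two_path_mutate ::
  "nat \<Rightarrow> (nat \<Rightarrow> nat \<Rightarrow> nat) \<Rightarrow> (nat \<Rightarrow> nat \<Rightarrow> nat \<Rightarrow> nat) \<Rightarrow> nat \<Rightarrow> nat \<Rightarrow> nat \<Rightarrow> nat" where
  "two_path_mutate k a p =
     (let added = (\<lambda>i l j. p i l j + p i k j * a k l);
          reversed = (\<lambda>i l j. if l = k then added j l i else added i l j)
      in (\<lambda>i l j. reversed i l j - reversed j l i))"

definition mutate :: "nat \<Rightarrow> ext_quiver \<Rightarrow> ext_quiver" where
  "mutate k Q = \<lparr>arr = quiver_mutate k (arr Q), tp = two_path_mutate k (arr Q) (tp Q)\<rparr>"


section \<open>Exchange relation and the 2-form\<close>

text \<open>
  In both definitions \<open>x\<close> and \<open>\<xi>\<close> are the values given to the even and odd variables.  The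
  products are over lists because superforms do not form a commutative type; for even \<open>x\<close> and odd
  \<open>\<xi>\<close> the factors are even, so their order is immaterial.

  With the coordinates \<open>X\<close> read as the mutated variables, the old x(k) is the solution z of
  \<open>z * X k = exchange_rhs n m Q k X \<Xi>\<close>, and substituting it into the 2-form of Q gives
  \<open>omega n m Q (X(k := z)) \<Xi>\<close>.  The right-hand side does not involve \<open>x k\<close>, as Q has no loops.
\<close>

definition exchange_rhs ::
  "nat \<Rightarrow> nat \<Rightarrow> ext_quiver \<Rightarrow> nat \<Rightarrow>
   (nat \<Rightarrow> 'k::field_char_0 superform) \<Rightarrow> (nat \<Rightarrow> 'k superform) \<Rightarrow> 'k superform" where
  "exchange_rhs n m Q k x \<xi> =
     prod_list [x l ^ arr Q k l. l \<leftarrow> [0..<n]] +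
     prod_list [(1 + \<xi> i * \<xi> j) ^ tp Q i k j. i \<leftarrow> [0..<m], j \<leftarrow> [0..<m]] *
     prod_list [x l ^ arr Q l k. l \<leftarrow> [0..<n]]"

definition omega ::
  "nat \<Rightarrow> nat \<Rightarrow> ext_quiver \<Rightarrow>
   (nat \<Rightarrow> 'k::field_char_0 superform) \<Rightarrow> (nat \<Rightarrow> 'k superform) \<Rightarrow> 'k superform" where
  "omega n m Q x \<xi> =
     (\<Sum>i<n. \<Sum>j<n. of_nat (arr Q i j) *
        ((ext_d n m (x i) * ext_d n m (x j)) / (x i * x j))) +
     (\<Sum>i<m. \<Sum>l<n. \<Sum>j<m. of_nat (tp Q i l j) *
        ((ext_d n m (\<xi> i * \<xi> j) * ext_d n m (x l)) / x l))"

end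

theory Submission
  imports Defs
begin

text \<open>
  Write \<open>dlog u = du / u\<close> for an even unit \<open>u\<close>.  Since the square of \<open>\<xi>(i) \<xi>(j)\<close> vanishes,
  \<open>dlog (1 + \<xi>(i) \<xi>(j)) = d(\<xi>(i) \<xi>(j))\<close>, so for the product \<open>T\<close> over the 2-paths through \<open>x(k)\<close>
  the form \<open>\<tau> = dlog T\<close> is exactly the sum of the \<open>d(\<xi>(i) \<xi>(j))\<close>.  With the products \<open>A\<close>, \<open>B\<close>
  over the outgoing and incoming arrows, \<open>\<alpha> = dlog A\<close>, \<open>\<beta> = dlog B\<close> and \<open>\<gamma> = \<beta> + \<tau>\<close>, the exchange
  relation reads \<open>dlog x(k) + dlog x'(k) = (A \<alpha> + T B \<gamma>) / (A + T B)\<close>.  The old \<open>x(k)\<close> occurs in the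
  form only in \<open>dlog x(k) \<and> (\<alpha> - \<gamma>)\<close>, which therefore equals \<open>- dlog x'(k) \<and> (\<alpha> - \<gamma>) + \<gamma> \<and> \<alpha>\<close>: the
  first summand reverses the arrows and 2-paths at \<open>k\<close>, and \<open>\<gamma> \<and> \<alpha> = \<beta> \<and> \<alpha> + \<tau> \<and> \<alpha>\<close> adds the new
  arrows and 2-paths.  Opposite pairs contribute opposite terms, so cancelling them is harmless.
\<close>

section \<open>Parity in Grassmann algebras\<close>

lemma shuffle_sign_sq [simp]: "shuffle_sign S T * shuffle_sign S T = (1 :: 'r::comm_ring_1)"
  by (simp add: shuffle_sign_def flip: power_mult_distrib)

lemma shuffle_sign_sq_left [simp]:
  "shuffle_sign S T * (shuffle_sign S T * c) = (c :: 'r::comm_ring_1)"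
  by (simp flip: mult.assoc)

text \<open>Since \<open>S\<close> and \<open>T\<close> are disjoint, each pair in
  \<open>S \<times> T\<close> is an inversion for exactly one of the two orders; hence the two
  inversion counts add up to \<open>card S * card T\<close>.\<close>

lemma shuffle_sign_swap:
  assumes "finite S" "finite T" "S \<inter> T = {}"
  shows "(shuffle_sign S T :: 'r::comm_ring_1) = (-1) ^ (card S * card T) * shuffle_sign T S"
proof -
  let ?I = "\<lambda>S T :: 'a set. {(s, t). s \<in> S \<and> t \<in> T \<and> t < s}"
  have fin: "finite (?I S T)" "finite (?I T S)"
    using assms by (auto intro: finite_subset[of _ "S \<times> T"] finite_subset[of _ "T \<times> S"])
  have "S \<times> T = ?I S T \<union> prod.swap ` ?I T S"
    using assms(3) by (auto simp: image_iff)
  moreover have "?I S T \<inter> prod.swap ` ?I T S = {}" by auto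
  ultimately have "card S * card T = card (?I S T) + card (?I T S)"
    using fin by (simp add: card_image card_Un_disjoint flip: card_cartesian_product)
  then have "(-1) ^ (card S * card T) * shuffle_sign T S =
      shuffle_sign S T * (shuffle_sign T S * shuffle_sign T S :: 'r)"
    by (simp add: shuffle_sign_def power_add mult.assoc)
  then show ?thesis by simp
qed

text \<open>\<open>True\<close> encodes even and \<open>False\<close> odd, so that elements of
  parities \<open>e\<close> and \<open>f\<close> have a product of parity \<open>e = f\<close>. The
  element 0 has both parities.\<close>

definition gr_parity :: "bool \<Rightarrow> ('g::linorder, 'r::comm_ring_1) grassmann \<Rightarrow> bool" where
  "gr_parity e a \<longleftrightarrow> (\<forall>S. gr_coeff a S \<noteq> 0 \<longrightarrow> even (card S) = e)"

abbreviation "gr_even \<equiv> gr_parity True"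
abbreviation "gr_odd \<equiv> gr_parity False"

lemma gr_parityD: "gr_parity e a \<Longrightarrow> even (card S) \<noteq> e \<Longrightarrow> gr_coeff a S = 0"
  by (auto simp: gr_parity_def)

lemma gr_parity_zero [simp]: "gr_parity e 0"
  by (simp add: gr_parity_def zero_grassmann.rep_eq)

lemma gr_even_one [simp]: "gr_even 1"
  by (simp add: gr_parity_def one_grassmann.rep_eq)

lemma gr_even_const [simp]: "gr_even (gr_const c)"
  by (simp add: gr_parity_def gr_const.rep_eq)

lemma gr_odd_gen [simp]: "gr_odd (gr_gen g)"
  by (simp add: gr_parity_def gr_gen.rep_eq)

lemma gr_parity_add: "gr_parity e a \<Longrightarrow> gr_parity e b \<Longrightarrow> gr_parity e (a + b)"
  unfolding gr_parity_def plus_grassmann.rep_eq by (metis add.left_neutral)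

lemma gr_parity_uminus [simp]: "gr_parity e (- a) = gr_parity e a"
  by (simp add: gr_parity_def uminus_grassmann.rep_eq)

lemma gr_parity_diff: "gr_parity e a \<Longrightarrow> gr_parity e b \<Longrightarrow> gr_parity e (a - b)"
  using gr_parity_add[of e a "- b"] by simp

lemma gr_parity_sum: "(\<And>i. i \<in> A \<Longrightarrow> gr_parity e (f i)) \<Longrightarrow> gr_parity e (sum f A)"
  by (induction A rule: infinite_finite_induct) (auto intro: gr_parity_add)

lemma gr_parity_mult:
  assumes "gr_parity e a" "gr_parity f b"
  shows "gr_parity (e = f) (a * b)"
  unfolding gr_parity_def
proof (intro allI impI)
  fix U
  assume nz: "gr_coeff (a * b) U \<noteq> 0"
  then have fin: "finite U" using gr_coeff_infinite by blast
  from nz obtain S where S: "S \<subseteq> U" "gr_coeff a S \<noteq> 0" "gr_coeff b (U - S) \<noteq> 0"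
    unfolding times_grassmann.rep_eq
    by (metis (no_types, lifting) Pow_iff mult_zero_left mult_zero_right sum.neutral)
  have "card U = card S + card (U - S)"
    using S(1) fin by (metis card_Diff_subset card_mono finite_subset le_add_diff_inverse)
  with S assms show "even (card U) = (e = f)" by (auto simp: gr_parity_def)
qed

lemma gr_even_mult: "gr_even a \<Longrightarrow> gr_parity e b \<Longrightarrow> gr_parity e (a * b)"
  using gr_parity_mult[of True a e b] by simp

lemma gr_even_mult_odd: "gr_odd a \<Longrightarrow> gr_even b \<Longrightarrow> gr_odd (a * b)"
  using gr_parity_mult[of False a True b] by simp

lemma gr_odd_mult: "gr_odd a \<Longrightarrow> gr_odd b \<Longrightarrow> gr_even (a * b)"
  using gr_parity_mult[of False a False b] by simp

text \<open>Passing to complements in \<open>U\<close> makes \<open>b * a\<close> run over the same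
  splittings as \<open>a * b\<close>, up to a sign in each summand. Both commutation laws are read
  off from that sign.\<close>

lemma gr_coeff_mult_swap:
  assumes "finite U"
  shows "gr_coeff (b * a) U =
    (\<Sum>S\<in>Pow U. (-1) ^ (card S * card (U - S)) * (shuffle_sign S (U - S) * gr_coeff a S * gr_coeff b (U - S)))"
proof -
  have "gr_coeff (b * a) U = (\<Sum>S\<in>Pow U. shuffle_sign (U - S) S * gr_coeff b (U - S) * gr_coeff a S)"
    unfolding times_grassmann.rep_eq
    by (rule sum.reindex_bij_witness[where i = "\<lambda>S. U - S" and j = "\<lambda>S. U - S"])
      (auto simp: double_diff)
  also have "\<dots> = (\<Sum>S\<in>Pow U. (-1) ^ (card S * card (U - S)) *
      (shuffle_sign S (U - S) * gr_coeff a S * gr_coeff b (U - S)))"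
  proof (rule sum.cong)
    fix S assume "S \<in> Pow U"
    then have "finite S" using assms by (auto dest: finite_subset)
    then have "(shuffle_sign (U - S) S :: 'b) = (-1) ^ (card S * card (U - S)) * shuffle_sign S (U - S)"
      using assms by (subst shuffle_sign_swap) (auto simp: mult.commute)
    then show "shuffle_sign (U - S) S * gr_coeff b (U - S) * gr_coeff a S =
        (-1) ^ (card S * card (U - S)) * (shuffle_sign S (U - S) * gr_coeff a S * gr_coeff b (U - S))"
      by (simp add: mult_ac)
  qed simp
  finally show ?thesis .
qed

lemma gr_even_commute:
  assumes "gr_even a"
  shows "a * b = b * a"
proof (rule gr_eqI)
  fix U
  show "gr_coeff (a * b) U = gr_coeff (b * a) U"
  proof (cases "finite U")
    case True
    show ?thesis
      unfolding gr_coeff_mult_swap[OF True, of b a] unfolding times_grassmann.rep_eq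
    proof (rule sum.cong)
      fix S
      show "shuffle_sign S (U - S) * gr_coeff a S * gr_coeff b (U - S) =
        (-1) ^ (card S * card (U - S)) * (shuffle_sign S (U - S) * gr_coeff a S * gr_coeff b (U - S))"
        using gr_parityD[OF assms, of S] by (cases "even (card S)") auto
    qed simp
  qed (simp add: gr_coeff_infinite)
qed

lemma gr_even_left_commute: "gr_even a \<Longrightarrow> b * (a * c) = a * (b * c)"
  by (metis gr_even_commute mult.assoc)

lemma gr_odd_anticommute:
  assumes "gr_odd a" "gr_odd b"
  shows "a * b = - (b * a)"
proof (rule gr_eqI)
  fix U
  show "gr_coeff (a * b) U = gr_coeff (- (b * a)) U"
  proof (cases "finite U")
    case True
    show ?thesis
      unfolding gr_coeff_mult_swap[OF True, of b a] uminus_grassmann.rep_eq sum_negf[symmetric]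
      unfolding times_grassmann.rep_eq
    proof (rule sum.cong)
      fix S
      show "shuffle_sign S (U - S) * gr_coeff a S * gr_coeff b (U - S) =
        - ((-1) ^ (card S * card (U - S)) * (shuffle_sign S (U - S) * gr_coeff a S * gr_coeff b (U - S)))"
        using gr_parityD[OF assms(1), of S] gr_parityD[OF assms(2), of "U - S"]
        by (cases "even (card S)"; cases "even (card (U - S))") auto
    qed simp
  qed (simp add: gr_coeff_infinite)
qed

section \<open>Derivations\<close>

lemma gr_parity_contract:
  assumes "gr_parity e a"
  shows "gr_parity (\<not> e) (gr_contract g a)"
  unfolding gr_parity_def
proof (intro allI impI)
  fix S
  assume "gr_coeff (gr_contract g a) S \<noteq> 0"
  then have "g \<notin> S" "gr_coeff a (insert g S) \<noteq> 0"
    by (auto simp: gr_contract.rep_eq split: if_splits)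
  moreover from this have "finite S" using gr_coeff_infinite by (metis finite_insert)
  ultimately show "even (card S) = (\<not> e)"
    using assms by (force simp: gr_parity_def)
qed

text \<open>Contraction is an odd derivation; moving it past \<open>a\<close> costs
  \<open>(-1) ^ card S\<close>, which is 1 on the support of the even \<open>a\<close>. For
  \<open>g\<close> outside \<open>U\<close> the subsets of \<open>insert g U\<close> are sorted by
  whether they contain \<open>g\<close>; for \<open>g\<close> in \<open>U\<close> the left side
  vanishes and the right side cancels in pairs.\<close>

lemma gr_contract_mult:
  assumes "gr_even a"
  shows "gr_contract g (a * b) = gr_contract g a * b + a * gr_contract g b"
proof (rule gr_eqI)
  fix U
  show "gr_coeff (gr_contract g (a * b)) U = gr_coeff (gr_contract g a * b + a * gr_contract g b) U"
  proof (cases "finite U \<and> g \<notin> U")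
    case True
    then have fin: "finite U" and g: "g \<notin> U" by auto
    let ?a = "gr_coeff a" and ?b = "gr_coeff b"
    let ?t = "\<lambda>S. shuffle_sign {g} U * (shuffle_sign S (insert g U - S) * ?a S * ?b (insert g U - S))"
    have disj: "Pow U \<inter> insert g ` Pow U = {}" using g by auto
    have inj: "inj_on (insert g) (Pow U)" using g by (auto simp: inj_on_def)
    have "gr_coeff (gr_contract g (a * b)) U = (\<Sum>S\<in>Pow (insert g U). ?t S)"
      using g by (simp add: gr_contract.rep_eq times_grassmann.rep_eq sum_distrib_left)
    also have "\<dots> = (\<Sum>S\<in>Pow U. ?t S) + (\<Sum>S\<in>Pow U. ?t (insert g S))"
      using fin disj inj by (simp add: Pow_insert sum.union_disjoint sum.reindex)
    \<comment> \<open>Here \<open>g\<close> lies in the complement, so the derivative falls on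
      \<open>b\<close>.\<close>
    also have "(\<Sum>S\<in>Pow U. ?t S) = gr_coeff (a * gr_contract g b) U"
      unfolding times_grassmann.rep_eq
    proof (rule sum.cong)
      fix S assume S: "S \<in> Pow U"
      then have fS: "finite S" using fin by (auto dest: finite_subset)
      have i: "insert g U - S = insert g (U - S)" using S g by auto
      have "(shuffle_sign {g} (S \<union> (U - S)) :: 'b) = shuffle_sign {g} S * shuffle_sign {g} (U - S)"
        by (rule shuffle_sign_union_right) (use fin fS in auto)
      moreover have "S \<union> (U - S) = U" using S by auto
      moreover have "(shuffle_sign S ({g} \<union> (U - S)) :: 'b) = shuffle_sign S {g} * shuffle_sign S (U - S)"
        by (rule shuffle_sign_union_right) (use fin fS g in auto)
      moreover have "(shuffle_sign {g} S :: 'b) = (-1) ^ card S * shuffle_sign S {g}"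
        using shuffle_sign_swap[of "{g}" S] fS g S by auto
      ultimately have "?t S = shuffle_sign {g} (U - S) * (shuffle_sign S (U - S) *
          (((-1) ^ card S * ?a S) * ?b (insert g (U - S))))"
        by (simp add: i mult_ac)
      also have "(-1) ^ card S * ?a S = ?a S"
        using gr_parityD[OF assms, of S] by (cases "even (card S)") auto
      finally show "?t S = shuffle_sign S (U - S) * ?a S * gr_coeff (gr_contract g b) (U - S)"
        using g by (simp add: gr_contract.rep_eq mult_ac)
    qed simp
    \<comment> \<open>Here \<open>g\<close> lies in the left part, so the derivative falls on
      \<open>a\<close>.\<close>
    also have "(\<Sum>S\<in>Pow U. ?t (insert g S)) = gr_coeff (gr_contract g a * b) U"
      unfolding times_grassmann.rep_eq
    proof (rule sum.cong)
      fix S assume S: "S \<in> Pow U"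
      then have fS: "finite S" using fin by (auto dest: finite_subset)
      have i: "insert g U - insert g S = U - S" using g by auto
      have "(shuffle_sign {g} (S \<union> (U - S)) :: 'b) = shuffle_sign {g} S * shuffle_sign {g} (U - S)"
        by (rule shuffle_sign_union_right) (use fin fS in auto)
      moreover have "S \<union> (U - S) = U" using S by auto
      moreover have "(shuffle_sign ({g} \<union> S) (U - S) :: 'b) = shuffle_sign {g} (U - S) * shuffle_sign S (U - S)"
        by (rule shuffle_sign_union_left) (use fin fS g S in auto)
      ultimately have "?t (insert g S) = shuffle_sign {g} S * (shuffle_sign S (U - S) * (?a (insert g S) * ?b (U - S)))"
        by (simp add: i mult.assoc)
      then show "?t (insert g S) = shuffle_sign S (U - S) * gr_coeff (gr_contract g a) S * ?b (U - S)"
        using g S by (auto simp: gr_contract.rep_eq mult_ac)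
    qed simp
    finally show ?thesis by (simp add: plus_grassmann.rep_eq add.commute)
  next
    case False
    show ?thesis
    proof (cases "finite U")
      case True
      with False have g: "g \<in> U" by simp
      define V where "V = U - {g}"
      have U: "U = insert g V" and gV: "g \<notin> V" and fin: "finite V"
        using g True by (auto simp: V_def)
      let ?a = "gr_coeff a" and ?b = "gr_coeff b"
      have disj: "Pow V \<inter> insert g ` Pow V = {}" using gV by auto
      have inj: "inj_on (insert g) (Pow V)" using gV by (auto simp: inj_on_def)
      have split: "sum f (Pow U) = (\<Sum>S\<in>Pow V. f S + f (insert g S))" for f :: "'a set \<Rightarrow> 'b"
        using fin disj inj by (simp add: U Pow_insert sum.union_disjoint sum.reindex sum.distrib)
      \<comment> \<open>The summand of the first product at \<open>S\<close> cancels that of the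
        second at \<open>insert g S\<close>. The other two summands vanish because \<open>g\<close>
        stays in the argument of the contraction.\<close>
      have "gr_coeff (gr_contract g a * b + a * gr_contract g b) U = 0"
        unfolding plus_grassmann.rep_eq times_grassmann.rep_eq split
        unfolding sum.distrib[symmetric]
      proof (rule sum.neutral, rule ballI)
        fix S assume S: "S \<in> Pow V"
        then have fS: "finite S" and gS: "g \<notin> S" using fin gV by (auto dest: finite_subset)
        have i: "insert g V - insert g S = V - S" "insert g V - S = insert g (V - S)"
          using gV gS by auto
        have un: "(shuffle_sign ({g} \<union> S) (V - S) :: 'b) = shuffle_sign {g} (V - S) * shuffle_sign S (V - S)"
          "(shuffle_sign S ({g} \<union> (V - S)) :: 'b) = shuffle_sign S {g} * shuffle_sign S (V - S)"
          by (rule shuffle_sign_union_left shuffle_sign_union_right; use fin fS gS gV in auto)+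
        have sw: "(shuffle_sign {g} S :: 'b) = (-1) ^ card S * shuffle_sign S {g}"
          using shuffle_sign_swap[of "{g}" S] fS gS by auto
        let ?c = "shuffle_sign S (V - S) * ?b (insert g (V - S))"
        have "shuffle_sign S (U - S) * gr_coeff (gr_contract g a) S * ?b (U - S) =
            ((-1) ^ card S * ?a (insert g S)) * ?c"
          using gS un sw by (simp add: gr_contract.rep_eq U i mult_ac)
        \<comment> \<open>A nonzero coefficient at \<open>insert g S\<close> forces
          \<open>card S\<close> to be odd; this is the sign that makes the pair cancel.\<close>
        also have "(-1) ^ card S * ?a (insert g S) = - ?a (insert g S)"
          using gr_parityD[OF assms, of "insert g S"] fS gS by (cases "even (card S)") auto
        finally have t1: "shuffle_sign S (U - S) * gr_coeff (gr_contract g a) S * ?b (U - S) =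
            - ?a (insert g S) * ?c" .
        have t2: "shuffle_sign (insert g S) (U - insert g S) * ?a (insert g S) *
            gr_coeff (gr_contract g b) (U - insert g S) = ?a (insert g S) * ?c"
          using gV un by (simp add: gr_contract.rep_eq U i mult_ac)
        show "shuffle_sign S (U - S) * gr_coeff (gr_contract g a) S * ?b (U - S) +
            shuffle_sign (insert g S) (U - insert g S) * gr_coeff (gr_contract g a) (insert g S) *
              ?b (U - insert g S) +
            (shuffle_sign S (U - S) * ?a S * gr_coeff (gr_contract g b) (U - S) +
             shuffle_sign (insert g S) (U - insert g S) * ?a (insert g S) *
              gr_coeff (gr_contract g b) (U - insert g S)) = 0"
          unfolding t1 t2 using g gS by (simp add: gr_contract.rep_eq)
      qed
      with g show ?thesis by (simp add: gr_contract.rep_eq)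
    qed (simp add: gr_coeff_infinite)
  qed
qed

lemma gr_contract_add: "gr_contract g (a + b) = gr_contract g a + gr_contract g b"
  by (rule gr_eqI) (simp add: gr_contract.rep_eq plus_grassmann.rep_eq distrib_left)

section \<open>Derivations acting on coefficients\<close>

context
  fixes h :: "'r::comm_ring_1 \<Rightarrow> 'r"
  assumes h_add: "\<And>x y. h (x + y) = h x + h y"
begin

text \<open>\<open>gr_map\<close> sends zero coefficients to 0 by definition; an additive
  \<open>h\<close> does so by itself, and the case distinction disappears.\<close>

lemma gr_coeff_map: "gr_coeff (gr_map h a) S = h (gr_coeff a S)"
  using h_add[of 0 0] by (simp add: gr_map.rep_eq)

lemma gr_map_add: "gr_map h (a + b) = gr_map h a + gr_map h b"
  by (rule gr_eqI) (simp add: gr_coeff_map plus_grassmann.rep_eq h_add)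

lemma gr_parity_map: "gr_parity e a \<Longrightarrow> gr_parity e (gr_map h a)"
  using h_add[of 0 0] by (auto simp: gr_parity_def gr_coeff_map) (metis add_cancel_left_left)+

text \<open>An additive \<open>h\<close> commutes with finite sums and with signs, so its Leibniz
  rule can be applied inside the product formula.\<close>

lemma gr_map_mult:
  assumes h_mult: "\<And>x y. h (x * y) = h x * y + x * h y"
  shows "gr_map h (a * b) = gr_map h a * b + a * gr_map h b"
proof (rule gr_eqI)
  fix U
  have h0: "h 0 = 0" using h_add[of 0 0] by simp
  have h_uminus: "h (- x) = - h x" for x
    using h_add[of x "- x"] h0 by (simp add: eq_neg_iff_add_eq_0 add.commute)
  have h_sign: "h (shuffle_sign S T * x) = shuffle_sign S T * h x"
    for S T :: "'c::linorder set" and x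
    by (cases "even (card {(s, t). s \<in> S \<and> t \<in> T \<and> t < s})") (auto simp: shuffle_sign_def h_uminus)
  have h_sum: "h (sum f A) = (\<Sum>i\<in>A. h (f i))" for f :: "'c set \<Rightarrow> 'r" and A
    by (induction A rule: infinite_finite_induct) (simp_all add: h0 h_add)
  have "gr_coeff (gr_map h (a * b)) U =
      (\<Sum>S\<in>Pow U. shuffle_sign S (U - S) * h (gr_coeff a S * gr_coeff b (U - S)))"
    by (simp only: gr_coeff_map times_grassmann.rep_eq h_sum h_sign mult.assoc)
  then show "gr_coeff (gr_map h (a * b)) U = gr_coeff (gr_map h a * b + a * gr_map h b) U"
    by (simp add: gr_coeff_map plus_grassmann.rep_eq times_grassmann.rep_eq mult.assoc h_mult distrib_left flip: sum.distrib)
qed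

end

lemma rat_deriv_add: "rat_deriv i (x + y) = rat_deriv i x + rat_deriv i (y :: 'k::idom ratfun)"
proof (cases x; cases y)
  fix p q r s :: "'k mpoly"
  assume xy: "x = Fract p q" "q \<noteq> 0" "y = Fract r s" "s \<noteq> 0"
  \<comment> \<open>With the derivatives abbreviated and denominators cleared, the claim is a
    polynomial identity in eight independent symbols.\<close>
  define p' q' r' s' where d: "p' = mpoly_deriv i p" "q' = mpoly_deriv i q"
    "r' = mpoly_deriv i r" "s' = mpoly_deriv i s"
  have "((p' * s + p * s' + (r' * q + r * q')) * (q * s) - (p * s + r * q) * (q' * s + q * s')) *
      (q * q * (s * s)) =
    ((p' * q - p * q') * (s * s) + (r' * s - r * s') * (q * q)) * (q * s * (q * s))"
    by algebra
  then show ?thesis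
    using xy(2,4) unfolding xy(1,3)
    by (simp only: add_fract rat_deriv_Fract mult_eq_0_iff eq_fract mpoly_deriv_add mpoly_deriv_mult
        d[symmetric] simp_thms)
qed

lemma rat_deriv_mult: "rat_deriv i (x * y) = rat_deriv i x * y + x * rat_deriv i (y :: 'k::idom ratfun)"
proof (cases x; cases y)
  fix p q r s :: "'k mpoly"
  assume xy: "x = Fract p q" "q \<noteq> 0" "y = Fract r s" "s \<noteq> 0"
  define p' q' r' s' where d: "p' = mpoly_deriv i p" "q' = mpoly_deriv i q"
    "r' = mpoly_deriv i r" "s' = mpoly_deriv i s"
  have "((p' * r + p * r') * (q * s) - p * r * (q' * s + q * s')) * (q * q * s * (q * (s * s))) =
    ((p' * q - p * q') * r * (q * (s * s)) + p * (r' * s - r * s') * (q * q * s)) * (q * s * (q * s))"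
    by algebra
  then show ?thesis
    using xy(2,4) unfolding xy(1,3)
    by (simp only: add_fract mult_fract rat_deriv_Fract mult_eq_0_iff eq_fract mpoly_deriv_mult
        d[symmetric] simp_thms)
qed

context
  fixes h :: "'r::comm_ring_1 \<Rightarrow> 'r"
  assumes h_add: "\<And>x y. h (x + y) = h x + h y"
begin

lemma lookup_map_additive: "Poly_Mapping.lookup (Poly_Mapping.map h p) \<alpha> = h (Poly_Mapping.lookup p \<alpha>)"
  using h_add[of 0 0] by (simp add: map.rep_eq when_def)

lemma mpoly_map_add:
  "Poly_Mapping.map h (p + q) = Poly_Mapping.map h p + Poly_Mapping.map h q"
  by (rule poly_mapping_eqI) (simp add: lookup_map_additive lookup_add h_add)

text \<open>Both sides are biadditive, so monomials suffice; there \<open>h\<close> acts on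
  coefficients and leaves exponents alone. The intended \<open>h\<close> is
  \<open>rat_deriv i\<close>, acting on polynomials in the dxi(j).\<close>

lemma mpoly_map_mult:
  assumes h_mult: "\<And>x y. h (x * y) = h x * y + x * h y"
  shows "Poly_Mapping.map h (p * q) = Poly_Mapping.map h p * q + p * Poly_Mapping.map h (q :: 'r mpoly)"
proof -
  let ?h = "Poly_Mapping.map h :: 'r mpoly \<Rightarrow> 'r mpoly"
  let ?P = "\<lambda>\<alpha>. Poly_Mapping.single \<alpha> (Poly_Mapping.lookup p \<alpha>)"
  let ?Q = "\<lambda>\<alpha>. Poly_Mapping.single \<alpha> (Poly_Mapping.lookup q \<alpha>)"
  let ?K = "Poly_Mapping.keys p" and ?L = "Poly_Mapping.keys q"
  have h0: "h 0 = 0" using h_add[of 0 0] by simp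
  have map_single: "?h (Poly_Mapping.single \<alpha> c) = Poly_Mapping.single \<alpha> (h c)" for \<alpha> c
    by (rule poly_mapping_eqI) (simp add: lookup_map_additive lookup_single when_def h0)
  have map_zero: "?h 0 = 0"
    by (rule poly_mapping_eqI) (simp add: lookup_map_additive h0)
  have map_sum: "?h (sum f A) = (\<Sum>i\<in>A. ?h (f i))" for f :: "(nat \<Rightarrow>\<^sub>0 nat) \<Rightarrow> 'r mpoly" and A
    by (induction A rule: infinite_finite_induct)
      (simp_all add: mpoly_map_add map_zero)
  have p: "p = sum ?P ?K" and q: "q = sum ?Q ?L" by (rule mpoly_eq_sum_single)+
  have "?h (sum ?P ?K * sum ?Q ?L) = ?h (sum ?P ?K) * sum ?Q ?L + sum ?P ?K * ?h (sum ?Q ?L)"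
    by (simp add: sum_product map_sum map_single mult_single h_mult single_add sum.distrib)
  then show ?thesis using p q by simp
qed

end

section \<open>The exterior differential\<close>

lemma partial_even_add: "partial_even i (a + b) = partial_even i a + partial_even i b"
  unfolding partial_even_def by (intro gr_map_add mpoly_map_add rat_deriv_add)

lemma partial_even_mult: "partial_even i (a * b) = partial_even i a * b + a * partial_even i b"
  unfolding partial_even_def
  by (intro gr_map_mult mpoly_map_add mpoly_map_mult rat_deriv_add rat_deriv_mult)

lemma gr_parity_partial_even: "gr_parity e a \<Longrightarrow> gr_parity e (partial_even i a)"
  unfolding partial_even_def by (intro gr_parity_map mpoly_map_add rat_deriv_add)

lemma ext_d_add: "ext_d n m (a + b) = ext_d n m a + ext_d n m b"
  by (simp add: ext_d_def partial_even_add partial_odd_def gr_contract_add distrib_left sum.distrib)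

text \<open>An even \<open>a\<close> is central and passes the odd \<open>dX i\<close> without a
  sign, so the graded Leibniz rule is the ordinary one.\<close>

lemma ext_d_mult:
  assumes "gr_even a"
  shows "ext_d n m (a * b) = ext_d n m a * b + a * ext_d n m b"
  using assms
  by (simp add: ext_d_def partial_even_mult partial_odd_def gr_contract_mult distrib_left
      distrib_right sum.distrib sum_distrib_left sum_distrib_right mult.assoc gr_even_left_commute)

lemma ext_d_zero [simp]: "ext_d n m 0 = 0"
  using ext_d_add[of n m 0 0] by simp

lemma ext_d_one [simp]: "ext_d n m 1 = 0"
  using ext_d_mult[of 1 n m 1] by simp

lemma ext_d_uminus: "ext_d n m (- a) = - ext_d n m a"
  using ext_d_add[of n m a "- a"] by (simp add: eq_neg_iff_add_eq_0 add.commute)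

lemma ext_d_odd:
  assumes "gr_even a"
  shows "gr_odd (ext_d n m a)"
  unfolding ext_d_def
proof (intro gr_parity_add gr_parity_sum)
  show "gr_odd (dX i * partial_even i a)" for i
    using assms by (auto simp: dX_def intro: gr_even_mult_odd gr_parity_partial_even)
  show "gr_odd (d\<Xi> j * partial_odd j a)" for j
    using gr_parity_contract[OF assms, of "Xi j"]
    by (auto simp: d\<Xi>_def partial_odd_def intro: gr_even_mult)
qed

section \<open>Logarithmic differentials\<close>

text \<open>Both \<open>u\<close> and its inverse are required to be even, hence central: a
  one-sided inverse is then two-sided, and quotients can be reordered.\<close>

definition even_unit :: "('g::linorder, 'r::comm_ring_1) grassmann \<Rightarrow> bool" where
  "even_unit u \<longleftrightarrow> gr_even u \<and> (\<exists>v. gr_even v \<and> u * v = 1)"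

lemma even_unit_even: "even_unit u \<Longrightarrow> gr_even u"
  by (simp add: even_unit_def)

lemma even_unit_inverse:
  assumes "even_unit u"
  shows "gr_even (inverse u)" "u * inverse u = 1" "inverse u * u = 1"
proof -
  from assms obtain v where v: "gr_even v" "u * v = 1" and u: "gr_even u"
    by (auto simp: even_unit_def)
  then have vu: "v * u = 1" by (simp add: gr_even_commute)
  have "(THE b. u * b = 1 \<and> b * u = 1) = v"
    by (rule the_equality) (use v vu in \<open>auto, metis mult.assoc mult.left_neutral mult.right_neutral\<close>)
  then have "inverse u = v" using v vu by (auto simp: inverse_grassmann_def)
  then show "gr_even (inverse u)" "u * inverse u = 1" "inverse u * u = 1" using v vu by auto
qed

lemma even_unit_divide_eq:
  assumes "even_unit u" "w * u = a"
  shows "a / u = w"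
  using even_unit_inverse[OF assms(1)] assms(2) by (metis divide_grassmann_def mult.assoc mult.right_neutral)

lemma even_unit_cancel: "even_unit u \<Longrightarrow> a * u = b * u \<Longrightarrow> a = b"
  by (metis even_unit_divide_eq)

lemma even_unit_one [simp]: "even_unit 1"
  by (auto simp: even_unit_def intro: exI[of _ 1])

lemma even_unit_mult: "even_unit u \<Longrightarrow> even_unit v \<Longrightarrow> even_unit (u * v)"
  unfolding even_unit_def
proof (elim conjE exE, intro conjI)
  fix u' v' assume *: "gr_even u" "gr_even v" "gr_even u'" "gr_even v'" "u * u' = 1" "v * v' = 1"
  then show "gr_even (u * v)" by (simp add: gr_even_mult)
  have "u * v * (v' * u') = u * (v * v') * u'" by (simp add: mult.assoc)
  then show "\<exists>w. gr_even w \<and> u * v * w = 1"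
    using * by (intro exI[of _ "v' * u'"]) (simp add: gr_even_mult)
qed

lemma even_unit_power: "even_unit u \<Longrightarrow> even_unit (u ^ c)"
  by (induction c) (auto intro: even_unit_mult)

lemma even_unit_prod_list: "(\<And>u. u \<in> set us \<Longrightarrow> even_unit u) \<Longrightarrow> even_unit (prod_list us)"
  by (induction us) (auto intro: even_unit_mult)

text \<open>For the inverse \<open>v\<close> of \<open>u\<close>, the geometric series of
  \<open>u * (1 + v * w)\<close> stops after the linear term and gives the inverse
  \<open>v - v * w * v\<close>.\<close>

lemma even_unit_add_square_zero:
  assumes "even_unit u" "gr_even w" "w * w = 0"
  shows "even_unit (u + w)"
proof -
  from assms obtain v where v: "gr_even v" "u * v = 1" and u: "gr_even u"
    by (auto simp: even_unit_def)
  have "w * (v * w * v) = w * w * (v * v)"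
    using v by (simp add: mult.assoc gr_even_left_commute)
  moreover have "u * (v * w * v) = w * v"
    using v by (simp flip: mult.assoc)
  ultimately have "(u + w) * (v - v * w * v) = 1"
    using v assms(3) by (simp add: distrib_right right_diff_distrib)
  moreover have "gr_even (v - v * w * v)" "gr_even (u + w)"
    using u v assms(2) by (simp_all add: gr_parity_add gr_parity_diff gr_even_mult)
  ultimately show ?thesis by (auto simp: even_unit_def)
qed

text \<open>This passes from \<open>A + B\<close> to \<open>A + T * B\<close>: each further factor
  \<open>u\<close> adds \<open>u - 1\<close> times the current second summand, an even element of
  square 0.\<close>

lemma even_unit_add_prod_list_mult:
  assumes "gr_even a" "gr_even b" "even_unit (a + b)"
    and "\<And>u. u \<in> set us \<Longrightarrow> gr_even u \<and> (u - 1) * (u - 1) = 0"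
  shows "gr_even (prod_list us) \<and> even_unit (a + prod_list us * b)"
  using assms(4)
proof (induction us)
  case (Cons u us)
  let ?c = "prod_list us * b"
  have u: "gr_even u" "(u - 1) * (u - 1) = 0" and us: "gr_even (prod_list us)" "even_unit (a + ?c)"
    using Cons by auto
  have e: "gr_even (u - 1)" "gr_even ?c" using u us assms(2) by (auto intro: gr_parity_diff gr_even_mult)
  have "(u - 1) * ?c * ((u - 1) * ?c) = (u - 1) * (?c * (u - 1)) * ?c"
    by (simp only: mult.assoc)
  also have "\<dots> = (u - 1) * (u - 1) * (?c * ?c)"
    unfolding gr_even_commute[OF e(1), of ?c, symmetric] by (simp only: mult.assoc)
  also have "\<dots> = 0" using u(2) by simp
  finally have unit: "even_unit (a + ?c + (u - 1) * ?c)"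
    by (rule even_unit_add_square_zero[OF us(2) gr_even_mult[OF e]])
  have sum: "a + ?c + (u - 1) * ?c = a + prod_list (u # us) * b"
    by (simp add: left_diff_distrib mult.assoc)
  show ?case
    using gr_even_mult[OF u(1) us(1)] unit unfolding sum by simp
qed (simp add: assms(3))

definition dlog :: "nat \<Rightarrow> nat \<Rightarrow> 'k::field_char_0 superform \<Rightarrow> 'k superform" where
  "dlog n m u = ext_d n m u * inverse u"

lemma dlog_mult_self: "even_unit u \<Longrightarrow> dlog n m u * u = ext_d n m u"
  by (simp add: dlog_def mult.assoc even_unit_inverse)

lemma dlog_eqI: "even_unit u \<Longrightarrow> w * u = ext_d n m u \<Longrightarrow> dlog n m u = w"
  by (metis dlog_mult_self even_unit_cancel)

lemma dlog_odd: "even_unit u \<Longrightarrow> gr_odd (dlog n m u)"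
  unfolding dlog_def by (intro gr_even_mult_odd ext_d_odd even_unit_inverse even_unit_even)

lemma dlog_one [simp]: "dlog n m 1 = 0"
  by (simp add: dlog_def)

lemma dlog_mult:
  assumes "even_unit u" "even_unit v"
  shows "dlog n m (u * v) = dlog n m u + dlog n m v"
proof (rule dlog_eqI)
  have "(dlog n m u + dlog n m v) * (u * v) = dlog n m u * u * v + u * (dlog n m v * v)"
    using assms by (simp add: distrib_right mult.assoc gr_even_left_commute even_unit_even)
  then show "(dlog n m u + dlog n m v) * (u * v) = ext_d n m (u * v)"
    using assms by (simp add: dlog_mult_self ext_d_mult even_unit_even)
qed (use assms in \<open>rule even_unit_mult\<close>)

lemma dlog_power: "even_unit u \<Longrightarrow> dlog n m (u ^ c) = of_nat c * dlog n m u"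
  by (induction c) (simp_all add: dlog_mult even_unit_power distrib_right)

lemma dlog_prod_list:
  "(\<And>u. u \<in> set us \<Longrightarrow> even_unit u) \<Longrightarrow> dlog n m (prod_list us) = (\<Sum>u\<leftarrow>us. dlog n m u)"
  by (induction us) (simp_all add: dlog_mult even_unit_prod_list)

section \<open>Coordinates\<close>

lemma gr_const_mult: "gr_const (c * d) = gr_const c * gr_const d"
proof (rule gr_eqI)
  fix U :: "'a set"
  have "(\<Sum>S\<in>Pow U. shuffle_sign S (U - S) * (if S = {} then c else 0) * (if U - S = {} then d else 0))
     = (\<Sum>S\<in>Pow U. if S = {} \<and> U = {} then c * d else 0)"
    by (rule sum.cong) auto
  then show "gr_coeff (gr_const (c * d)) U = gr_coeff (gr_const c * gr_const d) U"
    by (cases "U = {}") (simp_all add: times_grassmann.rep_eq gr_const.rep_eq)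
qed

lemma gr_const_add: "gr_const (c + d) = gr_const c + gr_const d"
  by (rule gr_eqI) (simp add: gr_const.rep_eq plus_grassmann.rep_eq)

text \<open>The ring embedding of the rational functions as scalar forms, through which units of the
  field become even units.\<close>

definition rat_form :: "'k::field_char_0 ratfun \<Rightarrow> 'k superform" where
  "rat_form f = gr_const (Poly_Mapping.single 0 f)"

lemma rat_form_one [simp]: "rat_form 1 = 1"
  by (simp add: rat_form_def)

lemma rat_form_mult: "rat_form (f * g) = rat_form f * rat_form g"
  by (simp add: rat_form_def mult_single flip: gr_const_mult)

lemma rat_form_add: "rat_form (f + g) = rat_form f + rat_form g"
  by (simp add: rat_form_def single_add flip: gr_const_add)

lemma even_unit_rat_form:
  assumes "f \<noteq> 0"
  shows "even_unit (rat_form f)"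
proof -
  have "rat_form f * rat_form (inverse f) = 1"
    using assms by (simp flip: rat_form_mult)
  then show ?thesis unfolding even_unit_def by (metis gr_even_const rat_form_def)
qed

lemma X_eq_rat_form: "X i = rat_form (Fract (mvar i) 1)"
  by (simp add: X_def rat_form_def)

lemma even_unit_X: "even_unit (X i)"
  unfolding X_eq_rat_form
proof (rule even_unit_rat_form)
  have "mvar i \<noteq> (0 :: 'a mpoly)"
    by (metis mvar_def lookup_single_eq lookup_zero zero_neq_one)
  then show "Fract (mvar i :: 'a mpoly) 1 \<noteq> 0" by (simp add: Zero_fract_def eq_fract)
qed

text \<open>The coefficient is fixed to be 1: products preserve this, and it keeps a sum of two
  monomials from cancelling.\<close>

definition monomial_form :: "'k::field_char_0 superform \<Rightarrow> bool" where
  "monomial_form u \<longleftrightarrow> (\<exists>\<alpha>. u = rat_form (Fract (Poly_Mapping.single \<alpha> 1) 1))"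

lemma monomial_form_one: "monomial_form 1"
  unfolding monomial_form_def by (rule exI[of _ 0]) (simp add: fract_collapse)

lemma monomial_form_X: "monomial_form (X i)"
  unfolding monomial_form_def X_eq_rat_form mvar_def by blast

lemma monomial_form_mult: "monomial_form u \<Longrightarrow> monomial_form v \<Longrightarrow> monomial_form (u * v)"
  unfolding monomial_form_def by (auto simp: mult_single simp flip: rat_form_mult)

lemma monomial_form_power: "monomial_form u \<Longrightarrow> monomial_form (u ^ c)"
  by (induction c) (auto intro: monomial_form_mult monomial_form_one)

lemma monomial_form_prod_list:
  "(\<And>u. u \<in> set us \<Longrightarrow> monomial_form u) \<Longrightarrow> monomial_form (prod_list us)"
  by (induction us) (auto intro: monomial_form_mult monomial_form_one)

text \<open>In characteristic 0 the sum of two monomials is nonzero even if they coincide.\<close>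

lemma even_unit_add_monomials:
  assumes "monomial_form u" "monomial_form v"
  shows "even_unit (u + v)"
proof -
  obtain \<alpha> \<beta> where uv: "u = rat_form (Fract (Poly_Mapping.single \<alpha> 1) 1)"
    "v = rat_form (Fract (Poly_Mapping.single \<beta> 1) 1)"
    using assms by (auto simp: monomial_form_def)
  let ?p = "Poly_Mapping.single \<alpha> 1 + Poly_Mapping.single \<beta> 1 :: 'a mpoly"
  have "Poly_Mapping.lookup ?p \<alpha> \<noteq> 0"
    by (simp add: lookup_add lookup_single when_def)
  then have "?p \<noteq> 0" by (metis lookup_zero)
  then have "even_unit (rat_form (Fract ?p 1))"
    by (intro even_unit_rat_form) (simp add: Zero_fract_def eq_fract)
  then show ?thesis by (simp add: uv flip: rat_form_add)
qed

text \<open>Characteristic 0 of \<open>'k\<close> is carried up through polynomials, their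
  fractions, polynomials in the dxi(j) and exterior coefficients. It turns \<open>a = - a\<close>
  into \<open>a = 0\<close>.\<close>

lemma superform_double_eq_0: "a + a = 0 \<Longrightarrow> a = (0 :: 'k::field_char_0 superform)"
proof (rule gr_eqI, rule poly_mapping_eqI)
  fix S \<alpha>
  assume a: "a + a = 0"
  have double: "c = 0" if "c + c = 0" for c :: "'k ratfun"
  proof (cases c)
    case (Fract p q)
    have "(p + p) * (q * q) = 0"
      using that Fract by (simp add: Zero_fract_def eq_fract algebra_simps)
    then have "p + p = 0" using Fract by simp
    have "Poly_Mapping.lookup p \<gamma> = 0" for \<gamma>
    proof -
      have "2 * Poly_Mapping.lookup p \<gamma> = 0"
        by (metis \<open>p + p = 0\<close> lookup_add lookup_zero mult_2)
      then show ?thesis by simp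
    qed
    then have "p = 0" by (intro poly_mapping_eqI) simp
    then show ?thesis using Fract by (simp add: fract_collapse)
  qed
  have "Poly_Mapping.lookup (gr_coeff a S) \<alpha> + Poly_Mapping.lookup (gr_coeff a S) \<alpha> = 0"
    using a by (metis lookup_add lookup_zero plus_grassmann.rep_eq zero_grassmann.rep_eq)
  then have "Poly_Mapping.lookup (gr_coeff a S) \<alpha> = 0" by (rule double)
  then show "Poly_Mapping.lookup (gr_coeff a S) \<alpha> = Poly_Mapping.lookup (gr_coeff 0 S) \<alpha>"
    by (simp add: zero_grassmann.rep_eq)
qed

section \<open>Products of two odd variables\<close>

abbreviation d\<Xi>\<Xi> :: "nat \<Rightarrow> nat \<Rightarrow> nat \<Rightarrow> nat \<Rightarrow> 'k::field_char_0 superform" where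
  "d\<Xi>\<Xi> n m i j \<equiv> ext_d n m (\<Xi> i * \<Xi> j)"

lemma gr_even_\<Xi>\<Xi>: "gr_even (\<Xi> i * \<Xi> j)"
  by (simp add: \<Xi>_def gr_odd_mult)

lemma \<Xi>\<Xi>_sq: "\<Xi> i * \<Xi> j * (\<Xi> i * \<Xi> j) = 0"
proof -
  have "\<Xi> i * \<Xi> j * (\<Xi> i * \<Xi> j) = \<Xi> i * (\<Xi> j * \<Xi> i) * \<Xi> j"
    by (simp only: mult.assoc)
  also have "\<Xi> j * \<Xi> i = - (\<Xi> i * \<Xi> j)"
    unfolding \<Xi>_def by (rule gr_gen_anticommute)
  also have "\<Xi> i * - (\<Xi> i * \<Xi> j) * \<Xi> j = - (\<Xi> i * \<Xi> i * \<Xi> j * \<Xi> j)"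
    by (simp add: mult.assoc)
  also have "\<dots> = 0" by (simp add: \<Xi>_def gr_gen_sq)
  finally show ?thesis .
qed

lemma d\<Xi>\<Xi>_antisym: "d\<Xi>\<Xi> n m i j = - d\<Xi>\<Xi> n m j i"
proof -
  have "\<Xi> i * \<Xi> j = - (\<Xi> j * \<Xi> i :: 'a superform)"
    unfolding \<Xi>_def by (rule gr_gen_anticommute)
  then show ?thesis by (simp only: ext_d_uminus)
qed

lemma even_unit_one_plus_\<Xi>\<Xi>: "even_unit (1 + \<Xi> i * \<Xi> j)"
  by (rule even_unit_add_square_zero[OF even_unit_one gr_even_\<Xi>\<Xi> \<Xi>\<Xi>_sq])

text \<open>For \<open>w = \<Xi> i * \<Xi> j\<close>, differentiating \<open>w * w = 0\<close> gives
  twice \<open>ext_d n m w * w\<close>, because \<open>w\<close> is central. So this product is 0,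
  and multiplying \<open>ext_d n m w\<close> by \<open>1 + w\<close> does not change it.\<close>

lemma dlog_one_plus_\<Xi>\<Xi>:
  "dlog n m (1 + \<Xi> i * \<Xi> j) = (d\<Xi>\<Xi> n m i j :: 'k::field_char_0 superform)"
proof -
  define w :: "'k superform" where "w = \<Xi> i * \<Xi> j"
  have even: "gr_even w" and sq: "w * w = 0"
    unfolding w_def by (rule gr_even_\<Xi>\<Xi>, rule \<Xi>\<Xi>_sq)
  have unit: "even_unit (1 + w)"
    unfolding w_def by (rule even_unit_one_plus_\<Xi>\<Xi>)
  have "ext_d n m w * w + w * ext_d n m w = 0"
    using ext_d_mult[OF even, of n m w] sq by simp
  then have "ext_d n m w * w = 0"
    unfolding gr_even_commute[OF even] by (rule superform_double_eq_0)
  then have "ext_d n m w * (1 + w) = ext_d n m (1 + w)"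
    by (simp add: distrib_left ext_d_add)
  then show ?thesis
    unfolding w_def[symmetric] by (rule dlog_eqI[OF unit])
qed

lemma one_plus_power_square_zero:
  assumes "w * w = (0 :: 'a::ring_1)"
  shows "(1 + w) ^ c = 1 + of_nat c * w"
proof (induction c)
  case (Suc c)
  have "w * (of_nat c * w) = of_nat c * (w * w)"
    by (metis mult.assoc mult_of_nat_commute)
  then have "w * (of_nat c * w) = 0" using assms by simp
  then show ?case by (simp add: Suc distrib_left distrib_right)
qed simp

section \<open>Mutation of quadratic expressions\<close>

text \<open>Transposing the indices shows that the sum is its own negative; absence of 2-torsion
  also disposes of the diagonal.\<close>

lemma double_sum_antisym_eq_0:
  fixes w :: "nat \<Rightarrow> nat \<Rightarrow> 'a::ab_group_add"
  assumes "\<forall>a::'a. a + a = 0 \<longrightarrow> a = 0" and w: "\<And>i j. w i j = - w j i"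
  shows "(\<Sum>i<n. \<Sum>j<n. w i j) = 0"
proof (rule assms(1)[rule_format])
  have "(\<Sum>i<n. \<Sum>j<n. w i j) = (\<Sum>i<n. \<Sum>j<n. - w j i)"
    by (intro sum.cong refl w)
  also have "\<dots> = - (\<Sum>i<n. \<Sum>j<n. w i j)"
    unfolding sum_negf by (subst sum.swap) (rule refl)
  finally show "(\<Sum>i<n. \<Sum>j<n. w i j) + (\<Sum>i<n. \<Sum>j<n. w i j) = 0"
    by (simp add: eq_neg_iff_add_eq_0)
qed

text \<open>Truncated subtraction removes \<open>min (r i j) (r j i)\<close>, which is symmetric and
  therefore sums to 0 against the antisymmetric \<open>w\<close>.\<close>

lemma double_sum_cancel_opposite:
  fixes w :: "nat \<Rightarrow> nat \<Rightarrow> 'a::ring_1" and r :: "nat \<Rightarrow> nat \<Rightarrow> nat"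
  assumes "\<forall>a::'a. a + a = 0 \<longrightarrow> a = 0" and w: "\<And>i j. w i j = - w j i"
  shows "(\<Sum>i<n. \<Sum>j<n. of_nat (r i j - r j i) * w i j) = (\<Sum>i<n. \<Sum>j<n. of_nat (r i j) * w i j)"
proof -
  have "of_nat (r i j) * w i j = of_nat (r i j - r j i) * w i j + of_nat (min (r i j) (r j i)) * w i j"
    for i j by (simp add: min_def flip: distrib_right of_nat_add)
  moreover have "(\<Sum>i<n. \<Sum>j<n. of_nat (min (r i j) (r j i)) * w i j) = 0"
    by (rule double_sum_antisym_eq_0[OF assms(1)]) (subst w, simp add: min.commute)
  ultimately show ?thesis by (simp add: sum.distrib)
qed

lemma mult_of_nat_left_commute: "x * (of_nat c * w) = of_nat c * (x * (w :: 'a::ring_1))"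
  by (metis mult.assoc mult_of_nat_commute)

text \<open>Without a loop at \<open>k\<close> the quadratic sum is affine in \<open>y k\<close>, so
  \<open>z - y k\<close> enters only through the arrows out of \<open>k\<close>, on the left, and
  into \<open>k\<close>, on the right.\<close>

lemma double_sum_fun_upd:
  fixes y :: "nat \<Rightarrow> 'a::ring_1"
  assumes "k < n" "a k k = 0"
  shows "(\<Sum>i<n. \<Sum>j<n. of_nat (a i j) * ((y(k := z)) i * (y(k := z)) j)) =
    (\<Sum>i<n. \<Sum>j<n. of_nat (a i j) * (y i * y j)) +
    (z - y k) * (\<Sum>j<n. of_nat (a k j) * y j) + (\<Sum>i<n. of_nat (a i k) * y i) * (z - y k)"
proof -
  have 1: "of_nat (a i j) * ((y(k := z)) i * (y(k := z)) j) = of_nat (a i j) * (y i * y j) +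
      (if i = k then (z - y k) * (of_nat (a k j) * y j) else 0) +
      (if j = k then of_nat (a i k) * y i * (z - y k) else 0)" for i j
    using assms(2) by (auto simp: left_diff_distrib right_diff_distrib mult.assoc
      mult_of_nat_left_commute)
  have 2: "(\<Sum>i<n. \<Sum>j<n. if i = k then f j else 0) = sum f {..<n}" for f :: "nat \<Rightarrow> 'a"
    using assms(1) by (subst sum.swap) simp
  show ?thesis
    unfolding 1 sum.distrib 2 sum_distrib_left sum_distrib_right using assms(1) by simp
qed

text \<open>\<open>\<beta> * \<alpha>\<close> collects the arrows composed through \<open>k\<close>;
  the two negative terms delete the arrows at \<open>k\<close>, and the last two terms insert them
  reversed.\<close>

lemma double_sum_quiver_mutate:
  fixes y :: "nat \<Rightarrow> 'a::ring_1" and a :: "nat \<Rightarrow> nat \<Rightarrow> nat"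
    and n k :: nat
  assumes "\<forall>a::'a. a + a = 0 \<longrightarrow> a = 0" and y: "\<And>i j. y i * y j = - (y j * y i)"
    and k: "k < n" "a k k = 0"
  defines "\<alpha> \<equiv> \<Sum>j<n. of_nat (a k j) * y j" and "\<beta> \<equiv> \<Sum>i<n. of_nat (a i k) * y i"
  shows "(\<Sum>i<n. \<Sum>j<n. of_nat (quiver_mutate k a i j) * (y i * y j)) =
    (\<Sum>i<n. \<Sum>j<n. of_nat (a i j) * (y i * y j)) +
    \<beta> * \<alpha> - y k * \<alpha> - \<beta> * y k + y k * \<beta> + \<alpha> * y k"
proof -
  \<comment> \<open>\<open>?r\<close> counts arrows after adding and reversing, before opposite
    pairs are cancelled. Where \<open>i = k\<close> or \<open>j = k\<close> the composed part is 0,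
    for lack of a loop.\<close>
  let ?r = "\<lambda>i j. if i = k \<or> j = k then a j i + a j k * a k i else a i j + a i k * a k j"
  have 1: "of_nat (?r i j) * (y i * y j) = of_nat (a i j) * (y i * y j) +
      of_nat (a i k) * y i * (of_nat (a k j) * y j) -
      (if i = k then y k * (of_nat (a k j) * y j) else 0) -
      (if j = k then of_nat (a i k) * y i * y k else 0) +
      (if i = k then y k * (of_nat (a j k) * y j) else 0) +
      (if j = k then of_nat (a k i) * y i * y k else 0)" for i j
  proof -
    have "of_nat (a i k) * y i * (of_nat (a k j) * y j) = of_nat (a i k * a k j) * (y i * y j)"
      by (simp add: mult.assoc mult_of_nat_left_commute[of "y i"])
    then show ?thesis
      using k(2) by (auto simp: distrib_right mult.assoc mult_of_nat_left_commute[of "y k"])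
  qed
  have 2: "(\<Sum>i<n. \<Sum>j<n. if i = k then f j else 0) = sum f {..<n}" for f :: "nat \<Rightarrow> 'a"
    using k(1) by (subst sum.swap) simp
  have "(\<Sum>i<n. \<Sum>j<n. of_nat (quiver_mutate k a i j) * (y i * y j)) =
      (\<Sum>i<n. \<Sum>j<n. of_nat (?r i j - ?r j i) * (y i * y j))"
    by (simp add: quiver_mutate_def Let_def)
  also have "\<dots> = (\<Sum>i<n. \<Sum>j<n. of_nat (?r i j) * (y i * y j))"
    using assms(1) y by (rule double_sum_cancel_opposite)
  also have "\<dots> = (\<Sum>i<n. \<Sum>j<n. of_nat (a i j) * (y i * y j)) +
    \<beta> * \<alpha> - y k * \<alpha> - \<beta> * y k + y k * \<beta> + \<alpha> * y k"
    unfolding 1 sum.distrib sum_subtractf 2 \<alpha>_def \<beta>_def sum_product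
    unfolding sum_distrib_left sum_distrib_right using k(1) by simp
  finally show ?thesis .
qed

text \<open>A 2-path visits one even vertex, so the sum is additive in \<open>y\<close> and only the
  2-paths through \<open>k\<close> feel the update.\<close>

lemma triple_sum_fun_upd:
  fixes y :: "nat \<Rightarrow> 'a::ring_1" and m n k :: nat
  assumes "k < n"
  shows "(\<Sum>i<m. \<Sum>l<n. \<Sum>j<m. of_nat (p i l j) * (e i j * (y(k := z)) l)) =
    (\<Sum>i<m. \<Sum>l<n. \<Sum>j<m. of_nat (p i l j) * (e i j * y l)) +
    (\<Sum>i<m. \<Sum>j<m. of_nat (p i k j) * e i j) * (z - y k)"
proof -
  have 1: "of_nat (p i l j) * (e i j * (y(k := z)) l) = of_nat (p i l j) * (e i j * y l) +
      (if l = k then of_nat (p i k j) * e i j * (z - y k) else 0)" for i l j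
    by (simp add: right_diff_distrib mult.assoc)
  have 2: "(\<Sum>l<n. \<Sum>j<m. if l = k then f j else 0) = sum f {..<m}" for f :: "nat \<Rightarrow> 'a"
    using assms(1) by (subst sum.swap) simp
  show ?thesis
    unfolding 1 sum.distrib 2 sum_distrib_right by simp
qed

text \<open>The product with \<open>\<tau>\<close> collects the added 2-paths. Reversal at
  \<open>k\<close> swaps the arguments of \<open>e\<close> and so negates
  \<open>\<tau> * y k\<close>, which is why this term is subtracted twice.\<close>

lemma triple_sum_two_path_mutate:
  fixes y :: "nat \<Rightarrow> 'a::ring_1" and a :: "nat \<Rightarrow> nat \<Rightarrow> nat" and p :: "nat \<Rightarrow> nat \<Rightarrow> nat \<Rightarrow> nat"
    and m n k :: nat
  assumes "\<forall>a::'a. a + a = 0 \<longrightarrow> a = 0" and e: "\<And>i j. e i j = - e j i"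
    and k: "k < n" "a k k = 0"
  defines "\<tau> \<equiv> \<Sum>i<m. \<Sum>j<m. of_nat (p i k j) * e i j"
  shows "(\<Sum>i<m. \<Sum>l<n. \<Sum>j<m. of_nat (two_path_mutate k a p i l j) * (e i j * y l)) =
    (\<Sum>i<m. \<Sum>l<n. \<Sum>j<m. of_nat (p i l j) * (e i j * y l)) +
    \<tau> * (\<Sum>l<n. of_nat (a k l) * y l) - \<tau> * y k - \<tau> * y k"
proof -
  \<comment> \<open>The even vertex comes first because opposite 2-paths cancel at each
    \<open>l\<close> separately, where \<open>?r l\<close> is a matrix in the odd endpoints.\<close>
  let ?r = "\<lambda>l i j. if l = k then p j l i + p j k i * a k l else p i l j + p i k j * a k l"
  have anti: "e i j * y l = - (e j i * y l)" for i j l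
    by (subst e) simp
  have rev: "(\<Sum>i<m. \<Sum>j<m. of_nat (p j k i) * (e i j * y k)) = - (\<tau> * y k)"
  proof -
    have "(\<Sum>i<m. \<Sum>j<m. of_nat (p j k i) * (e i j * y k)) =
        (\<Sum>i<m. \<Sum>j<m. - (of_nat (p j k i) * e j i * y k))"
      by (intro sum.cong refl) (subst anti, simp add: mult.assoc)
    also have "\<dots> = - (\<tau> * y k)"
      unfolding \<tau>_def sum_distrib_right sum_negf by (subst sum.swap) (rule refl)
    finally show ?thesis .
  qed
  have l: "(\<Sum>i<m. \<Sum>j<m. of_nat (?r l i j) * (e i j * y l)) =
      (\<Sum>i<m. \<Sum>j<m. of_nat (p i l j) * (e i j * y l)) + \<tau> * (of_nat (a k l) * y l) -
      (if l = k then \<tau> * y k + \<tau> * y k else 0)" for l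
  proof (cases "l = k")
    case True
    have "\<tau> * y k = (\<Sum>i<m. \<Sum>j<m. of_nat (p i k j) * (e i j * y k))"
      by (simp only: \<tau>_def sum_distrib_right mult.assoc)
    then show ?thesis using True k(2) rev by simp
  next
    case False
    have "of_nat (p i k j) * e i j * (of_nat (a k l) * y l) = of_nat (p i k j * a k l) * (e i j * y l)" for i j
      by (simp add: mult.assoc mult_of_nat_left_commute[of "e i j"])
    then have "\<tau> * (of_nat (a k l) * y l) = (\<Sum>i<m. \<Sum>j<m. of_nat (p i k j * a k l) * (e i j * y l))"
      by (simp only: \<tau>_def sum_distrib_right)
    with False show ?thesis by (simp add: distrib_right sum.distrib)
  qed
  have "(\<Sum>i<m. \<Sum>l<n. \<Sum>j<m. of_nat (two_path_mutate k a p i l j) * (e i j * y l)) =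
      (\<Sum>l<n. \<Sum>i<m. \<Sum>j<m. of_nat (?r l i j - ?r l j i) * (e i j * y l))"
    by (subst sum.swap) (simp add: two_path_mutate_def Let_def)
  also have "\<dots> = (\<Sum>l<n. \<Sum>i<m. \<Sum>j<m. of_nat (?r l i j) * (e i j * y l))"
    by (intro sum.cong refl double_sum_cancel_opposite assms(1) anti)
  also have "\<dots> = (\<Sum>i<m. \<Sum>l<n. \<Sum>j<m. of_nat (p i l j) * (e i j * y l)) +
    \<tau> * (\<Sum>l<n. of_nat (a k l) * y l) - \<tau> * y k - \<tau> * y k"
    unfolding l sum.distrib sum_subtractf sum_distrib_left[symmetric]
    using k(1) by (subst sum.swap) simp
  finally show ?thesis .
qed

section \<open>Invariance of the form\<close>

text \<open>The even value \<open>x i\<close> passes the second logarithmic differential, so the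
  quotient by \<open>x i * x j\<close> splits into two factors.\<close>

lemma omega_dlog:
  fixes x :: "nat \<Rightarrow> 'k::field_char_0 superform"
  assumes "\<And>i. i < n \<Longrightarrow> even_unit (x i)"
  shows "omega n m Q x \<Xi> =
    (\<Sum>i<n. \<Sum>j<n. of_nat (arr Q i j) * (dlog n m (x i) * dlog n m (x j))) +
    (\<Sum>i<m. \<Sum>l<n. \<Sum>j<m. of_nat (tp Q i l j) * (d\<Xi>\<Xi> n m i j * dlog n m (x l)))"
proof -
  have "ext_d n m (x i) * ext_d n m (x j) / (x i * x j) = dlog n m (x i) * dlog n m (x j)"
    if "i < n" "j < n" for i j
  proof (rule even_unit_divide_eq)
    have "dlog n m (x i) * dlog n m (x j) * (x i * x j) =
        (dlog n m (x i) * x i) * (dlog n m (x j) * x j)"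
      using assms[OF that(1)] by (simp add: mult.assoc gr_even_left_commute even_unit_even)
    then show "dlog n m (x i) * dlog n m (x j) * (x i * x j) = ext_d n m (x i) * ext_d n m (x j)"
      using assms that by (simp add: dlog_mult_self)
  qed (use assms that in \<open>blast intro: even_unit_mult\<close>)
  moreover have "d\<Xi>\<Xi> n m i j * ext_d n m (x l) / x l = d\<Xi>\<Xi> n m i j * dlog n m (x l)"
    for i j l by (simp add: divide_grassmann_def dlog_def mult.assoc)
  ultimately show ?thesis by (simp add: omega_def)
qed

section \<open>The factors of the exchange relation\<close>

definition exchange_odd :: "nat \<Rightarrow> ext_quiver \<Rightarrow> nat \<Rightarrow> 'k::field_char_0 superform" where
  "exchange_odd m Q k = prod_list [(1 + \<Xi> i * \<Xi> j) ^ tp Q i k j. i \<leftarrow> [0..<m], j \<leftarrow> [0..<m]]"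

lemma even_unit_exchange_odd: "even_unit (exchange_odd m Q k)"
  unfolding exchange_odd_def
  by (rule even_unit_prod_list) (auto intro: even_unit_power even_unit_one_plus_\<Xi>\<Xi>)

lemma sum_list_concat: "sum_list (concat xss) = (\<Sum>xs\<leftarrow>xss. sum_list xs)"
  by (induction xss) simp_all

lemma dlog_exchange_odd:
  "dlog n m (exchange_odd m Q k) = (\<Sum>i<m. \<Sum>j<m. of_nat (tp Q i k j) * d\<Xi>\<Xi> n m i j)"
proof -
  have "dlog n m (exchange_odd m Q k :: 'a superform) =
      (\<Sum>u\<leftarrow>[(1 + \<Xi> i * \<Xi> j) ^ tp Q i k j. i \<leftarrow> [0..<m], j \<leftarrow> [0..<m]]. dlog n m u)"
    unfolding exchange_odd_def
    by (rule dlog_prod_list) (auto intro: even_unit_power even_unit_one_plus_\<Xi>\<Xi>)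
  also have "\<dots> = (\<Sum>i\<leftarrow>[0..<m]. \<Sum>j\<leftarrow>[0..<m]. of_nat (tp Q i k j) * d\<Xi>\<Xi> n m i j)"
    by (simp add: map_concat sum_list_concat o_def dlog_power even_unit_one_plus_\<Xi>\<Xi> dlog_one_plus_\<Xi>\<Xi>)
  finally show ?thesis
    by (simp add: interv_sum_list_conv_sum_set_nat atLeast0LessThan)
qed

text \<open>Taking a row or a column of \<open>arr Q\<close> for \<open>c\<close> gives the two even
  products \<open>A\<close> and \<open>B\<close>.\<close>

definition X_monomial :: "nat \<Rightarrow> (nat \<Rightarrow> nat) \<Rightarrow> 'k::field_char_0 superform" where
  "X_monomial n c = prod_list [X l ^ c l. l \<leftarrow> [0..<n]]"

lemma monomial_form_X_monomial: "monomial_form (X_monomial n c)"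
  unfolding X_monomial_def
  by (rule monomial_form_prod_list) (auto intro: monomial_form_power monomial_form_X)

lemma even_unit_X_monomial: "even_unit (X_monomial n c)"
  unfolding X_monomial_def by (rule even_unit_prod_list) (auto intro: even_unit_power even_unit_X)

lemma dlog_X_monomial: "dlog n m (X_monomial n c) = (\<Sum>l<n. of_nat (c l) * dlog n m (X l))"
proof -
  have "dlog n m (X_monomial n c :: 'a superform) = (\<Sum>u\<leftarrow>[X l ^ c l. l \<leftarrow> [0..<n]]. dlog n m u)"
    unfolding X_monomial_def by (rule dlog_prod_list) (auto intro: even_unit_power even_unit_X)
  then show ?thesis
    by (simp add: o_def dlog_power even_unit_X interv_sum_list_conv_sum_set_nat atLeast0LessThan)
qed

lemma exchange_rhs_eq: "exchange_rhs n m Q k X \<Xi> =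
    X_monomial n (arr Q k) + exchange_odd m Q k * X_monomial n (\<lambda>l. arr Q l k)"
  by (simp add: exchange_rhs_def X_monomial_def exchange_odd_def)

text \<open>With the factor \<open>T\<close> left out this is a sum of two monomials, hence a unit.
  Each factor of \<open>T\<close> differs from 1 by a multiple of \<open>\<Xi> i * \<Xi> j\<close>,
  of square 0, so restoring the factors keeps it a unit.\<close>

lemma even_unit_exchange_rhs: "even_unit (exchange_rhs n m Q k X \<Xi>)"
  unfolding exchange_rhs_eq
proof -
  have "(u - 1) * (u - 1) = 0" if "u = (1 + \<Xi> i * \<Xi> j) ^ c" for u :: "'a superform" and i j c
  proof -
    let ?w = "\<Xi> i * \<Xi> j :: 'a superform"
    have "u - 1 = of_nat c * ?w"
      by (simp add: that one_plus_power_square_zero \<Xi>\<Xi>_sq)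
    then have "(u - 1) * (u - 1) = of_nat c * (?w * of_nat c) * ?w"
      by (simp only: mult.assoc)
    also have "?w * of_nat c = of_nat c * ?w" by (rule mult_of_nat_commute[symmetric])
    also have "of_nat c * (of_nat c * ?w) * ?w = of_nat c * (of_nat c * (?w * ?w))"
      by (simp only: mult.assoc)
    also have "\<dots> = 0" by (simp only: \<Xi>\<Xi>_sq mult_zero_right)
    finally show ?thesis .
  qed
  then have "gr_even (exchange_odd m Q k :: 'a superform) \<and>
    even_unit (X_monomial n (arr Q k) + exchange_odd m Q k * X_monomial n (\<lambda>l. arr Q l k) :: 'a superform)"
    unfolding exchange_odd_def
    by (intro even_unit_add_prod_list_mult even_unit_add_monomials monomial_form_X_monomial
        even_unit_even even_unit_X_monomial)
      (auto intro!: even_unit_even even_unit_power even_unit_one_plus_\<Xi>\<Xi>)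
  then show "even_unit (X_monomial n (arr Q k) + exchange_odd m Q k * X_monomial n (\<lambda>l. arr Q l k) :: 'a superform)"
    by blast
qed

text \<open>Both sides are \<open>(A \<alpha> + B \<gamma>) (\<alpha> - \<gamma>) / (A + B)\<close> for \<open>\<alpha> = dlog A\<close> and \<open>\<gamma> = dlog B\<close>.\<close>

lemma dlog_add_mult_diff:
  fixes A B :: "'k::field_char_0 superform" and n m :: nat
  assumes A: "even_unit A" and B: "even_unit B" and AB: "even_unit (A + B)"
  defines "\<alpha> \<equiv> dlog n m A" and "\<gamma> \<equiv> dlog n m B"
  shows "dlog n m (A + B) * (\<alpha> - \<gamma>) = \<gamma> * \<alpha>"
proof (rule even_unit_cancel[OF AB])
  have odd: "gr_odd \<alpha>" "gr_odd \<gamma>" using A B by (simp_all add: \<alpha>_def \<gamma>_def dlog_odd)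
  \<comment> \<open>An odd form anticommutes with itself, so its square vanishes once 2 is
    cancelled.\<close>
  have sq: "a * a = 0" if "gr_odd a" for a :: "'k superform"
    by (rule superform_double_eq_0, rule iffD1[OF eq_neg_iff_add_eq_0], rule gr_odd_anticommute[OF that that])
  have "dlog n m (A + B) * (\<alpha> - \<gamma>) * (A + B) = dlog n m (A + B) * (A + B) * (\<alpha> - \<gamma>)"
    using gr_even_commute[OF even_unit_even[OF AB], of "\<alpha> - \<gamma>"] by (simp add: mult.assoc)
  also have "dlog n m (A + B) * (A + B) = \<alpha> * A + \<gamma> * B"
    using A B AB by (simp add: dlog_mult_self ext_d_add \<alpha>_def \<gamma>_def)
  also have "(\<alpha> * A + \<gamma> * B) * (\<alpha> - \<gamma>) = \<alpha> * (\<alpha> - \<gamma>) * A + \<gamma> * (\<alpha> - \<gamma>) * B"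
    using gr_even_commute[OF even_unit_even[OF A], of "\<alpha> - \<gamma>"]
      gr_even_commute[OF even_unit_even[OF B], of "\<alpha> - \<gamma>"]
    by (simp add: distrib_right mult.assoc)
  \<comment> \<open>As squares vanish, both products reduce to \<open>\<gamma> * \<alpha>\<close>;
    this common value is what lets \<open>A + B\<close> cancel.\<close>
  also have "\<alpha> * (\<alpha> - \<gamma>) = \<gamma> * \<alpha>"
    using odd by (simp add: right_diff_distrib sq gr_odd_anticommute[of \<alpha> \<gamma>])
  also have "\<gamma> * (\<alpha> - \<gamma>) = \<gamma> * \<alpha>"
    using odd by (simp add: right_diff_distrib sq)
  finally show "dlog n m (A + B) * (\<alpha> - \<gamma>) * (A + B) = \<gamma> * \<alpha> * (A + B)"
    by (simp add: distrib_left)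
qed

theorem theorem3p2:
  fixes Q :: ext_quiver and n m k :: nat
  assumes "extended_quiver n m Q" and "k < n"
  shows "(\<exists>!z :: 'k::field_char_0 superform. z * X k = exchange_rhs n m Q k X \<Xi>) \<and>
    (\<forall>z :: 'k superform. z * X k = exchange_rhs n m Q k X \<Xi> \<longrightarrow>
       omega n m Q (X(k := z)) \<Xi> = omega n m (mutate k Q) X \<Xi>)"
proof (intro conjI allI impI)
  let ?E = "exchange_rhs n m Q k X \<Xi> :: 'k superform"
  show "\<exists>!z. z * X k = ?E"
  proof (rule ex1I)
    show "?E * inverse (X k) * X k = ?E"
      by (simp add: mult.assoc even_unit_inverse even_unit_X)
    show "z = ?E * inverse (X k)" if "z * X k = ?E" for z
      unfolding that[symmetric] by (simp add: mult.assoc even_unit_inverse even_unit_X)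
  qed
  fix z :: "'k superform"
  assume z: "z * X k = ?E"
  let ?y = "\<lambda>i. dlog n m (X i) :: 'k superform"
  let ?A = "X_monomial n (arr Q k) :: 'k superform"
  let ?B = "X_monomial n (\<lambda>l. arr Q l k) :: 'k superform"
  let ?T = "exchange_odd m Q k :: 'k superform"
  define \<alpha> \<beta> \<tau> where "\<alpha> = dlog n m ?A" and "\<beta> = dlog n m ?B" and "\<tau> = dlog n m ?T"
  have sums: "\<alpha> = (\<Sum>l<n. of_nat (arr Q k l) * ?y l)" "\<beta> = (\<Sum>l<n. of_nat (arr Q l k) * ?y l)"
    "\<tau> = (\<Sum>i<m. \<Sum>j<m. of_nat (tp Q i k j) * d\<Xi>\<Xi> n m i j)"
    by (simp_all only: \<alpha>_def \<beta>_def \<tau>_def dlog_X_monomial dlog_exchange_odd)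
  have loop: "arr Q k k = 0" using assms(1) by (simp add: extended_quiver_def)
  \<comment> \<open>The old variable is a product of two even units, so the rules for
    \<open>dlog\<close> apply to it.\<close>
  have "z = ?E * inverse (X k)"
    unfolding z[symmetric] by (simp add: mult.assoc even_unit_inverse even_unit_X)
  moreover have "even_unit (inverse (X k :: 'k superform))"
    using even_unit_inverse[OF even_unit_X, of k] even_unit_even[OF even_unit_X, of k]
    unfolding even_unit_def by blast
  ultimately have unit_z: "even_unit z" by (simp add: even_unit_mult even_unit_exchange_rhs)
  define \<zeta> where "\<zeta> = dlog n m z"
  have unit_x: "even_unit ((X(k := z)) i)" for i
    by (simp add: unit_z even_unit_X)
  \<comment> \<open>Replacing the coordinate amounts to replacing its logarithmic differential by
    \<open>\<zeta>\<close>, the shape that the update lemmas for the sums expect.\<close>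
  have dlog_x: "dlog n m ((X(k := z)) i) = (?y(k := \<zeta>)) i" for i
    by (simp add: \<zeta>_def)
  have odd: "gr_odd (?y i)" "gr_odd \<alpha>" "gr_odd \<beta>" "gr_odd \<tau>" "gr_odd \<zeta>" for i
    unfolding \<alpha>_def \<beta>_def \<tau>_def \<zeta>_def
    by (intro dlog_odd even_unit_X even_unit_X_monomial even_unit_exchange_odd unit_z)+
  have torsion_free: "\<forall>a::'k superform. a + a = 0 \<longrightarrow> a = 0"
    using superform_double_eq_0 by blast
  note anti = odd[THEN gr_odd_anticommute]
  \<comment> \<open>This is the logarithmic differential of the exchange relation.\<close>
  have "\<zeta> + ?y k = dlog n m (?A + ?T * ?B)"
    using dlog_mult[OF unit_z even_unit_X, of n m k] unfolding z \<zeta>_def by (simp add: exchange_rhs_eq)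
  moreover have "dlog n m (?T * ?B) = \<beta> + \<tau>"
    by (simp add: dlog_mult even_unit_exchange_odd even_unit_X_monomial \<beta>_def \<tau>_def add.commute)
  \<comment> \<open>The formula for a sum is used with \<open>T * B\<close> as second summand, so
    its \<open>\<gamma>\<close> is \<open>\<beta> + \<tau>\<close>.\<close>
  ultimately have key: "(\<zeta> + ?y k) * (\<alpha> - (\<beta> + \<tau>)) = (\<beta> + \<tau>) * \<alpha>"
    using dlog_add_mult_diff[of ?A "?T * ?B" n m] even_unit_exchange_rhs[of n m Q k, where ?'a = 'k]
    by (simp add: even_unit_X_monomial even_unit_mult even_unit_exchange_odd \<alpha>_def exchange_rhs_eq)
  \<comment> \<open>Both forms are written as the form of \<open>Q\<close> in the coordinates
    \<open>X\<close> plus a correction; only the corrections remain to be compared.\<close>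
  have omega: "omega n m Q (X(k := z)) \<Xi> =
      (\<Sum>i<n. \<Sum>j<n. of_nat (arr Q i j) * (?y i * ?y j)) + (\<zeta> - ?y k) * \<alpha> + \<beta> * (\<zeta> - ?y k) +
      ((\<Sum>i<m. \<Sum>l<n. \<Sum>j<m. of_nat (tp Q i l j) * (d\<Xi>\<Xi> n m i j * ?y l)) + \<tau> * (\<zeta> - ?y k))"
    unfolding omega_dlog[of n "X(k := z)", OF unit_x] dlog_x sums
      double_sum_fun_upd[OF assms(2), where y = ?y and a = "arr Q", OF loop]
      triple_sum_fun_upd[OF assms(2), where y = ?y]
    by (rule refl)
  have omega': "omega n m (mutate k Q) X \<Xi> =
      (\<Sum>i<n. \<Sum>j<n. of_nat (arr Q i j) * (?y i * ?y j)) +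
      \<beta> * \<alpha> - ?y k * \<alpha> - \<beta> * ?y k + ?y k * \<beta> + \<alpha> * ?y k +
      ((\<Sum>i<m. \<Sum>l<n. \<Sum>j<m. of_nat (tp Q i l j) * (d\<Xi>\<Xi> n m i j * ?y l)) +
        \<tau> * \<alpha> - \<tau> * ?y k - \<tau> * ?y k)"
    unfolding omega_dlog[of n X, OF even_unit_X] mutate_def ext_quiver.simps sums
      double_sum_quiver_mutate[OF torsion_free anti(1)[OF odd(1)] assms(2), where a = "arr Q", OF loop]
      triple_sum_two_path_mutate[OF torsion_free d\<Xi>\<Xi>_antisym assms(2), where a = "arr Q" and y = ?y, OF loop]
    by (rule refl)
  \<comment> \<open>After sorting the products of odd forms, the corrections differ by exactly the
    difference of the two sides of \<open>key\<close>.\<close>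
  have diff: "(\<zeta> - ?y k) * \<alpha> + \<beta> * (\<zeta> - ?y k) + \<tau> * (\<zeta> - ?y k) -
      (\<beta> * \<alpha> - ?y k * \<alpha> - \<beta> * ?y k + ?y k * \<beta> + \<alpha> * ?y k + \<tau> * \<alpha> - \<tau> * ?y k - \<tau> * ?y k) =
      (\<zeta> + ?y k) * (\<alpha> - (\<beta> + \<tau>)) - (\<beta> + \<tau>) * \<alpha>"
    by (simp add: algebra_simps anti(3)[OF odd(5)] anti(4)[OF odd(5)] anti(2)[OF odd(1), of k]
      anti(3)[OF odd(1), of k] anti(4)[OF odd(1), of k])
  have "omega n m Q (X(k := z)) \<Xi> - omega n m (mutate k Q) X \<Xi> = 0"
    using diff unfolding omega omega' key by (simp add: algebra_simps)
  then show "omega n m Q (X(k := z)) \<Xi> = omega n m (mutate k Q) X \<Xi>"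
    by simp
qed

end
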